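(* Consider the single-integrator network $\dot{\mathbf x}=-L\mathbf x+\mathbf w$ with output $\mathbf y=C\mathbf x$, zero initial condition and impulse input $\mathbf w(t)=\mathbf w_0\delta(t)$, where $\mathbf w_0\in\mathbb R^n$ is arbitrary. Then the performance metric $P=\int_0^\infty \mathbf y(t)^*\mathbf y(t)\,dt$ equals $$P=\operatorname{tr}(\Sigma_Q\Psi),\qquad \Sigma_Q=\tilde Q\,\mathbf w_0\mathbf w_0^*\,\tilde Q^*,$$ where $\Psi=[\Psi_{kl}]_{2\le k,l\le m}$ is the $(n-1)\times(n-1)$ block matrix whose block $\Psi_{kl}\in\mathbb C^{n_k\times n_l}$ has entries, for $q=1,\dots,n_k$ and $b=1,\dots,n_l$, $$[\Psi_{kl}]_{qb}=\sum_{p=1}^{q}\sum_{a=1}^{b}\nu_{d_k+p,\,d_l+a}\,\bigl\langle \tilde h^{(l)}_{ab},\tilde h^{(k)}_{pq}\bigr\rangle_{\mathcal L_2},$$ and for $p\le q$, $a\le b$, $$\bigl\langle \tilde h^{(l)}_{ab},\tilde h^{(k)}_{pq}\bigr\rangle_{\mathcal L_2}=\frac{(-1)^{b-a+q-p}\,\Phi}{\bigl(\overline{\lambda_k}+\lambda_l\bigr)^{b-a+q-p+1}},\qquad \Phi=\frac{(b-a+q-p)!}{(b-a)!\,(q-p)!}.$$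
   Context: Graph and Laplacian: $\mathcal G$ is a weighted directed graph on nodes $\{1,\dots,n\}$, $n\ge2$, without self-loops, with weights $b_{ij}>0$ if $(i,j)$ is an edge and $b_{ij}=0$ otherwise, having at least one globally reachable node (a node to which every other node has a directed path). $L$ is its weighted Laplacian: $[L]_{ii}=\sum_j b_{ij}$ and $[L]_{ij}=-b_{ij}$ for $i\ne j$. The output matrix $C\in\mathbb R^{q_0\times n}$ satisfies $C\mathbf 1=\mathbf 0$, where $\mathbf 1$ is the all-ones vector. Jordan decomposition: $L=RJR^{-1}$ with $J=\mathrm{blockdiag}(J_1,\dots,J_m)$, where $J_k\in\mathbb C^{n_k\times n_k}$ is an upper Jordan block (ones on the superdiagonal) with eigenvalue $\lambda_k$, and $J_1=\lambda_1=0$ is $1\times1$ (then $\mathrm{Re}\,\lambda_k>0$ for $k\ge2$). The columns of $R$ are $\mathbf r_1,\dots,\mathbf r_n$ with $\mathbf r_1=\alpha\mathbf 1$ for some $\alpha\in\mathbb C$. $\tilde Q\in\mathbb C^{(n-1)\times n}$ consists of the last $n-1$ rows of $R^{-1}$. $d_1=0$ and $d_k=\sum_{i=1}^{k-1}n_i$. $M=C^*C$ has an orthonormal eigenbasis $\boldsymbol\theta_1=\mathbf 1/\sqrt n,\boldsymbol\theta_2,\dots,\boldsymbol\theta_n$ with eigenvalues $\mu_1=0,\mu_2,\dots,\mu_n$, and for $\eta,\kappa\in\{2,\dots,n\}$, $\nu_{\eta,\kappa}=\sum_{l=2}^n(\mathbf r_\eta^*\boldsymbol\theta_l)(\boldsymbol\theta_l^*\mathbf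 r_\kappa)\mu_l$. For $k\in\{2,\dots,m\}$, $\tilde h^{(k)}_{pq}(t)$ ($1\le p\le q\le n_k$) is the inverse Laplace transform of the $(p,q)$ entry of the upper triangular matrix $\tilde H_k(s)=(sI+J_k)^{-1}$, i.e. $\tilde h^{(k)}_{pq}(s)=(-1)^{q-p}(s+\lambda_k)^{-(q-p+1)}$. The scalar product is $\langle u,v\rangle_{\mathcal L_2}=\int_0^\infty\overline{v(t)}\,u(t)\,dt$. *)

theory Defs
  imports
    "HOL-Probability.Probability"
    "Jordan_Normal_Form.Jordan_Normal_Form_Existence"
begin

unbundle no vec_syntax

text \<open>Vectors, matrices, nodes, Jordan blocks and matrix entries are all indexed from 0: node or
  column \<open>i + 1\<close> of the usual mathematical notation is \<open>i\<close> here, and the first Jordan block is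
  block \<open>0\<close>.\<close>

abbreviation complex_mat :: "real mat \<Rightarrow> complex mat" where
  "complex_mat \<equiv> map_mat complex_of_real"

abbreviation complex_vec :: "real vec \<Rightarrow> complex vec" where
  "complex_vec \<equiv> map_vec complex_of_real"

definition mat_trace :: "complex mat \<Rightarrow> complex" where
  "mat_trace A = (\<Sum>i<dim_row A. A $$ (i, i))"

definition block_offset :: "nat list \<Rightarrow> nat \<Rightarrow> nat" where
  "block_offset ns k = sum_list (take k ns)"

definition block_of :: "nat list \<Rightarrow> nat \<Rightarrow> nat" where
  "block_of ns i = (LEAST k. i < block_offset ns (Suc k))"

text \<open>The square block matrix whose \<open>(k, l)\<close> block is \<open>B k l\<close>, of size \<open>ns ! k\<close> times \<open>ns ! l\<close>.\<close>

definition block_mat :: "nat list \<Rightarrow> (nat \<Rightarrow> nat \<Rightarrow> complex mat) \<Rightarrow> complex mat" where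
  "block_mat ns B = mat (sum_list ns) (sum_list ns) (\<lambda>(i, j).
     let k = block_of ns i; l = block_of ns j
     in B k l $$ (i - block_offset ns k, j - block_offset ns l))"


definition weighted_digraph :: "nat \<Rightarrow> (nat \<Rightarrow> nat \<Rightarrow> real) \<Rightarrow> bool" where
  "weighted_digraph n b \<longleftrightarrow> (\<forall>i<n. \<forall>j<n. 0 \<le> b i j) \<and> (\<forall>i<n. b i i = 0)"

definition graph_edges :: "nat \<Rightarrow> (nat \<Rightarrow> nat \<Rightarrow> real) \<Rightarrow> (nat \<times> nat) set" where
  "graph_edges n b = {(i, j). i < n \<and> j < n \<and> 0 < b i j}"

definition globally_reachable :: "nat \<Rightarrow> (nat \<Rightarrow> nat \<Rightarrow> real) \<Rightarrow> nat \<Rightarrow> bool" where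
  "globally_reachable n b r \<longleftrightarrow> r < n \<and> (\<forall>i<n. (i, r) \<in> (graph_edges n b)\<^sup>*)"

definition laplacian :: "nat \<Rightarrow> (nat \<Rightarrow> nat \<Rightarrow> real) \<Rightarrow> real mat" where
  "laplacian n b = mat n n (\<lambda>(i, j). if i = j then (\<Sum>k<n. b i k) else - b i j)"


text \<open>\<open>x\<close> is the response of \<open>x' = A x + w \<delta>\<close>, at rest before time 0.  As \<open>\<delta>\<close> is the Dirac measure
  at 0, the equation is read as an equality of measures \<open>dx = A x dt + w d\<delta>\<close>, i.e. in its
  integrated form over every half-line \<open>{..t}\<close>.\<close>

definition impulse_response :: "real mat \<Rightarrow> real vec \<Rightarrow> (real \<Rightarrow> real vec) \<Rightarrow> bool" where
  "impulse_response A w x \<longleftrightarrow>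
     (\<forall>t. x t \<in> carrier_vec (dim_vec w)) \<and>
     (\<forall>t<0. x t = 0\<^sub>v (dim_vec w)) \<and>
     (\<forall>t. \<forall>i<dim_vec w.
        set_integrable lborel {..t} (\<lambda>u. (A *\<^sub>v x u) $ i) \<and>
        x t $ i = (LINT u:{..t}|lborel. (A *\<^sub>v x u) $ i)
                  + w $ i * measure (return borel 0) {..t})"

definition performance_metric :: "(real \<Rightarrow> real vec) \<Rightarrow> real" where
  "performance_metric y = (LINT t:{0..}|lborel. y t \<bullet>c y t)"


definition L2_inner :: "(real \<Rightarrow> complex) \<Rightarrow> (real \<Rightarrow> complex) \<Rightarrow> complex" where
  "L2_inner u v = (LINT t:{0..}|lborel. cnj (v t) * u t)"

text \<open>One-sided Laplace transforms.  Equality with \<open>F\<close> is required on some right half-plane of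
  absolute convergence.  Continuity on \<open>{0..}\<close> and vanishing on negative times single out one
  function among those with the same transform (Lerch's theorem), so that the definite
  description below is meaningful.\<close>

definition is_inverse_laplace :: "(complex \<Rightarrow> complex) \<Rightarrow> (real \<Rightarrow> complex) \<Rightarrow> bool" where
  "is_inverse_laplace F h \<longleftrightarrow>
     continuous_on {0..} h \<and> (\<forall>t<0. h t = 0) \<and>
     (\<exists>\<sigma>. \<forall>s. \<sigma> < Re s \<longrightarrow>
        set_integrable lborel {0..} (\<lambda>t. exp (- (s * complex_of_real t)) * h t) \<and>
        (LINT t:{0..}|lborel. exp (- (s * complex_of_real t)) * h t) = F s)"

definition inverse_laplace :: "(complex \<Rightarrow> complex) \<Rightarrow> real \<Rightarrow> complex" where
  "inverse_laplace F = (THE h. is_inverse_laplace F h)"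


text \<open>In the following, \<open>bs\<close> lists the pairs (size, eigenvalue) of the Jordan blocks, as in
  \<^const>\<open>jordan_matrix\<close>.\<close>

definition block_size :: "(nat \<times> complex) list \<Rightarrow> nat \<Rightarrow> nat" where
  "block_size bs k = fst (bs ! k)"

definition block_eigenvalue :: "(nat \<times> complex) list \<Rightarrow> nat \<Rightarrow> complex" where
  "block_eigenvalue bs k = snd (bs ! k)"

text \<open>The matrix \<open>(s I + J_k)^{-1}\<close>.  It is used only for \<open>s\<close> in a right half-plane, where the
  inverse exists.\<close>

definition H_tilde :: "(nat \<times> complex) list \<Rightarrow> nat \<Rightarrow> complex \<Rightarrow> complex mat" where
  "H_tilde bs k s = the (mat_inverse
     (s \<cdot>\<^sub>m 1\<^sub>m (block_size bs k) + jordan_block (block_size bs k) (block_eigenvalue bs k)))"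

definition h_tilde :: "(nat \<times> complex) list \<Rightarrow> nat \<Rightarrow> nat \<Rightarrow> nat \<Rightarrow> real \<Rightarrow> complex" where
  "h_tilde bs k p q = inverse_laplace (\<lambda>s. H_tilde bs k s $$ (p, q))"

definition \<nu> :: "nat \<Rightarrow> complex mat \<Rightarrow> (nat \<Rightarrow> complex vec) \<Rightarrow> (nat \<Rightarrow> complex) \<Rightarrow>
    nat \<Rightarrow> nat \<Rightarrow> complex" where
  "\<nu> n R \<theta> \<mu> \<eta> \<kappa> = (\<Sum>l\<in>{1..<n}. (\<theta> l \<bullet>c col R \<eta>) * (col R \<kappa> \<bullet>c \<theta> l) * \<mu> l)"

definition \<Psi>_block :: "nat \<Rightarrow> complex mat \<Rightarrow> (nat \<times> complex) list \<Rightarrow>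
    (nat \<Rightarrow> complex vec) \<Rightarrow> (nat \<Rightarrow> complex) \<Rightarrow> nat \<Rightarrow> nat \<Rightarrow> complex mat" where
  "\<Psi>_block n R bs \<theta> \<mu> k l = mat (block_size bs k) (block_size bs l) (\<lambda>(q, b).
     \<Sum>p\<le>q. \<Sum>a\<le>b.
       \<nu> n R \<theta> \<mu> (block_offset (map fst bs) k + p) (block_offset (map fst bs) l + a)
       * L2_inner (h_tilde bs l a b) (h_tilde bs k p q))"

text \<open>The block matrix runs over all Jordan blocks but the first one.\<close>

definition \<Psi> :: "nat \<Rightarrow> complex mat \<Rightarrow> (nat \<times> complex) list \<Rightarrow>
    (nat \<Rightarrow> complex vec) \<Rightarrow> (nat \<Rightarrow> complex) \<Rightarrow> complex mat" where
  "\<Psi> n R bs \<theta> \<mu> =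
     block_mat (map fst (tl bs)) (\<lambda>k l. \<Psi>_block n R bs \<theta> \<mu> (Suc k) (Suc l))"

definition Q_tilde :: "nat \<Rightarrow> complex mat \<Rightarrow> complex mat" where
  "Q_tilde n R_inv = mat (n - 1) n (\<lambda>(i, j). R_inv $$ (Suc i, j))"

definition \<Sigma>_Q :: "nat \<Rightarrow> complex mat \<Rightarrow> real vec \<Rightarrow> complex mat" where
  "\<Sigma>_Q n R_inv w0 =
     (let Q = Q_tilde n R_inv; W = mat_of_cols n [complex_vec w0]
      in Q * (W * mat_adjoint W) * mat_adjoint Q)"

end

theory Submission
  imports Defs "HOL-Real_Asymp.Real_Asymp"
begin

text \<open>In the coordinates \<open>z = R\<inverse> x\<close> the impulse response decouples into Jordan chains, and solving
  each chain from its last equation upwards gives \<open>z\<^sub>p = \<Sum>\<^bsub>q\<ge>p\<^esub> h\<^sub>p\<^sub>q w\<^sub>q\<close>, where the \<open>h\<^sub>p\<^sub>q\<close> are the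
  inverse transforms of \<open>(s I + J\<^sub>k)\<inverse>\<close>; that these are the only ones is Lerch's theorem.  The first
  mode is invisible in the output because \<open>C 1 = 0\<close>.  All other modes decay: a maximum modulus
  argument at the globally reachable node shows that eigenvectors of the Laplacian with eigenvalue in
  the closed left half-plane are constant.  Expanding \<open>y\<^sup>* y\<close> in the remaining modes, with \<open>C\<^sup>* C\<close>
  diagonalised by the \<open>\<theta> l\<close>, and integrating the products \<open>t\<^sup>k exp (- z t)\<close> gives the trace formula.\<close>

text \<open>\<open>inverse_laplace\<close> is a definite description, so no entry of
  \<open>H_tilde\<close> can be transformed back before uniqueness is settled; this is why the
  analysis comes first. The inverse of \<open>s I + J_k\<close> is a finite Neumann series in the
  nilpotent part, and it transforms back to the superdiagonals
  \<open>(- t)^d / d! * exp (- \<lambda> t)\<close> of \<open>exp (- t J_k)\<close>. A product of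
  two such entries, one conjugated, is a constant times \<open>t^(d + e)\<close> and an exponential;
  its integral brings in \<open>(d + e)!\<close>, and the \<open>d! e!\<close> already present
  completes the factor \<Phi>. Convergence needs
  \<open>Re (cnj \<lambda>_k + \<lambda>_l) > 0\<close>. This is not assumed: a further block might
  a priori carry the eigenvalue 0 or an unstable one, and reachability in the graph has to exclude
  it. In the energy, p and a index the modes that the output sees, q and b the initial values that
  feed them; sorting by initial values puts the sums over \<open>p \<le> q\<close> and
  \<open>a \<le> b\<close> inside the entries of \<open>\<Psi>\<close>.\<close>

section \<open>Integrals of exponential polynomials\<close>

text \<open>Dominated convergence reduces the half-line to compact intervals, where the usual
  theorem applies. Integrability is a hypothesis because a complex integrand may oscillate, so that
  a limit of the primitive alone would not give it.\<close>

lemma set_integral_FTC_atLeast: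
  fixes f F :: "real \<Rightarrow> 'a::euclidean_space"
  assumes int: "set_integrable lborel {a..} f"
    and cont: "continuous_on {a..} f"
    and deriv: "\<And>t. t \<ge> a \<Longrightarrow> (F has_vector_derivative f t) (at t within {a..})"
    and lim: "(F \<longlongrightarrow> L) at_top"
  shows "(LINT t:{a..}|lborel. f t) = L - F a"
proof -
  have "((\<lambda>b. LINT t|lborel. indicator {..b} t *\<^sub>R (indicator {a..} t *\<^sub>R f t)) \<longlongrightarrow>
      (LINT t|lborel. indicator {a..} t *\<^sub>R f t)) at_top"
    using int unfolding set_integrable_def by (intro tendsto_integral_at_top) auto
  moreover have "(LINT t|lborel. indicator {..b} t *\<^sub>R (indicator {a..} t *\<^sub>R f t)) = F b - F a"
    if "b \<ge> a" for b
  proof -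
    have "(LINT t|lborel. indicator {a..b} t *\<^sub>R f t) = F b - F a"
      using that
      by (intro integral_FTC_Icc has_vector_derivative_within_subset[OF deriv]
            continuous_on_subset[OF cont]) auto
    moreover have "indicator {a..b} t *\<^sub>R f t = indicator {..b} t *\<^sub>R (indicator {a..} t *\<^sub>R f t)" for t
      by (auto simp: indicator_def)
    ultimately show ?thesis by simp
  qed
  then have "\<forall>\<^sub>F b in at_top.
      (LINT t|lborel. indicator {..b} t *\<^sub>R (indicator {a..} t *\<^sub>R f t)) = F b - F a"
    by (rule eventually_mono[OF eventually_ge_at_top[of a]])
  ultimately have "((\<lambda>b. F b - F a) \<longlongrightarrow> (LINT t:{a..}|lborel. f t)) at_top"
    unfolding set_lebesgue_integral_def by (rule Lim_transform_eventually)
  then show ?thesis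
    using lim by (intro tendsto_unique[of at_top]) (auto intro: tendsto_diff)
qed

text \<open>The modulus of the integrand is \<open>t^k exp (- Re z t)\<close>, an Erlang density up
  to the factor \<open>fact k / Re z ^ Suc k\<close>.\<close>

lemma set_integrable_power_exp:
  assumes "Re z > 0"
  shows "set_integrable lborel {0..} (\<lambda>t. complex_of_real t ^ k * exp (- (z * complex_of_real t)))"
proof -
  have "(\<integral>\<^sup>+ t. ennreal (erlang_density k (Re z) t * t ^ 0) \<partial>lborel) < \<infinity>"
    using nn_integral_erlang_ith_moment[OF assms, of k 0] by simp
  then have "integrable lborel (erlang_density k (Re z))"
    using assms by (intro integrableI_bounded) auto
  then have "integrable lborel (\<lambda>t. fact k / Re z ^ Suc k * erlang_density k (Re z) t)"
    by (rule integrable_mult_right)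
  moreover have "fact k / Re z ^ Suc k * erlang_density k (Re z) t
      = norm (indicator {0..} t *\<^sub>R (complex_of_real t ^ k * exp (- (z * complex_of_real t))))" for t
    using assms by (simp add: erlang_density_def norm_mult norm_power indicator_def)
  ultimately show ?thesis
    unfolding set_integrable_def
    by (intro integrable_norm_cancel[where f="\<lambda>t. indicator {0..} t *\<^sub>R _ t"])
       (auto intro!: borel_measurable_continuous_onI continuous_intros)
qed

text \<open>Integration by parts in disguise: the derivative of \<open>- t^k exp (- z t) / z\<close>
  is the k-th integrand minus \<open>k / z\<close> times the previous one.\<close>

lemma set_integral_power_exp:
  assumes z: "Re z > 0"
  shows "(LINT t:{0..}|lborel. complex_of_real t ^ k * exp (- (z * complex_of_real t))) = fact k / z ^ Suc k"
proof -
  let ?e = "\<lambda>k t. complex_of_real t ^ k * exp (- (z * complex_of_real t))"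
  have z0: "z \<noteq> 0" using z by auto
  have lim: "((\<lambda>t. - ?e k t / z) \<longlongrightarrow> 0) at_top" for k
  proof -
    have "((\<lambda>t. t ^ k * exp (- (Re z * t))) \<longlongrightarrow> 0) at_top"
      using z by real_asymp
    moreover have "\<forall>\<^sub>F t in at_top. t ^ k * exp (- (Re z * t)) = norm (?e k t)"
      using eventually_ge_at_top[of "0::real"]
      by eventually_elim (simp add: norm_mult norm_power)
    ultimately have "((\<lambda>t. norm (?e k t)) \<longlongrightarrow> 0) at_top"
      by (rule Lim_transform_eventually)
    then have "((\<lambda>t. ?e k t) \<longlongrightarrow> 0) at_top" by (rule tendsto_norm_zero_cancel)
    from tendsto_divide[OF tendsto_minus[OF this] tendsto_const[of z]] z0 show ?thesis by simp
  qed
  have cont: "continuous_on S (?e k)" for k S by (intro continuous_intros)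
  show ?thesis
  proof (induction k)
    case 0
    have "(LINT t:{0..}|lborel. ?e 0 t) = 0 - (- ?e 0 0 / z)"
      by (rule set_integral_FTC_atLeast[OF set_integrable_power_exp[OF z] cont _ lim],
          rule has_vector_derivative_real_field)
         (use z0 in \<open>auto intro!: derivative_eq_intros\<close>)
    then show ?case by simp
  next
    case (Suc k)
    have i: "set_integrable lborel {0..} (\<lambda>t. (of_nat (Suc k) / z) * ?e k t)"
      using set_integrable_power_exp[OF z, of k] by (rule set_integrable_mult_right) 
    \<comment> \<open>The boundary terms vanish at infinity and, the power being positive, also at
      0, which leaves the recursion between the two integrals.\<close>
    have "(LINT t:{0..}|lborel. ?e (Suc k) t - (of_nat (Suc k) / z) * ?e k t) = 0 - (- ?e (Suc k) 0 / z)"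
    proof (rule set_integral_FTC_atLeast[OF _ _ _ lim])
      fix t :: real
      show "((\<lambda>t. - ?e (Suc k) t / z) has_vector_derivative ?e (Suc k) t - (of_nat (Suc k) / z) * ?e k t)
          (at t within {0..})"
        by (rule has_vector_derivative_real_field,
            use z0 in \<open>auto intro!: derivative_eq_intros simp: field_simps simp del: power_Suc\<close>,
            cases k, auto)
    next
      show "set_integrable lborel {0..} (\<lambda>t. ?e (Suc k) t - (of_nat (Suc k) / z) * ?e k t)"
        by (rule set_integral_diff(1)[OF set_integrable_power_exp[OF z] i])
      show "continuous_on {0..} (\<lambda>t. ?e (Suc k) t - (of_nat (Suc k) / z) * ?e k t)"
        by (intro continuous_on_diff continuous_on_mult[OF continuous_on_const] cont)
    qed
    moreover have "(LINT t:{0..}|lborel. ?e (Suc k) t - (of_nat (Suc k) / z) * ?e k t)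
       = (LINT t:{0..}|lborel. ?e (Suc k) t) - (of_nat (Suc k) / z) * (LINT t:{0..}|lborel. ?e k t)"
      by (subst set_integral_diff(2)[OF set_integrable_power_exp[OF z] i]) simp
    ultimately show ?case using Suc z0 by simp
  qed
qed

section \<open>Uniqueness of inverse Laplace transforms\<close>

text \<open>Under the substitution \<open>x = exp (- t)\<close> the values of a Laplace transform at
  equally spaced points become moments, and a polynomial in x is a finite combination of
  them.\<close>

lemma exp_moments_zero_polynomial:
  fixes g :: "real \<Rightarrow> complex"
  assumes moments: "\<And>k. set_integrable lborel {0..} (\<lambda>t. complex_of_real (exp (- t) ^ k) * g t)
        \<and> (LINT t:{0..}|lborel. complex_of_real (exp (- t) ^ k) * g t) = 0"
    and poly: "real_polynomial_function p"
  shows "set_integrable lborel {0..} (\<lambda>t. complex_of_real (p (exp (- t))) * g t)"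
    and "(LINT t:{0..}|lborel. complex_of_real (p (exp (- t))) * g t) = 0"
proof -
  obtain a N where p: "p = (\<lambda>x. \<Sum>i\<le>N. a i * x ^ i)"
    using poly by (auto simp: real_polynomial_function_iff_sum)
  have eq: "complex_of_real (p (exp (- t))) * g t
      = (\<Sum>i\<le>N. complex_of_real (a i) * (complex_of_real (exp (- t) ^ i) * g t))" for t
    by (simp add: p sum_distrib_right mult.assoc)
  have i: "set_integrable lborel {0..} (\<lambda>t. complex_of_real (a i) * (complex_of_real (exp (- t) ^ i) * g t))" for i
    using moments[of i] by (intro set_integrable_mult_right) auto
  show "set_integrable lborel {0..} (\<lambda>t. complex_of_real (p (exp (- t))) * g t)"
    unfolding eq using i unfolding set_integrable_def scaleR_sum_right by (rule Bochner_Integration.integrable_sum)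
  have "(LINT t:{0..}|lborel. complex_of_real (p (exp (- t))) * g t)
      = (\<Sum>i\<le>N. LINT t:{0..}|lborel. complex_of_real (a i) * (complex_of_real (exp (- t) ^ i) * g t))"
    unfolding eq set_lebesgue_integral_def scaleR_sum_right
    using i unfolding set_integrable_def by (intro Bochner_Integration.integral_sum) auto
  then show "(LINT t:{0..}|lborel. complex_of_real (p (exp (- t))) * g t) = 0"
    using moments by (simp only: set_integral_mult_right) simp
qed

text \<open>Weierstrass approximation on [0, 1], which contains all \<open>exp (- t)\<close> with
  \<open>t \<ge> 0\<close>: a uniform error e of the polynomial costs at most e times the L1 norm
  \<open>K\<close> of \<open>g\<close>.\<close>

lemma exp_moments_zero_continuous:
  fixes g :: "real \<Rightarrow> complex" and \<phi> :: "real \<Rightarrow> real"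
  assumes int: "set_integrable lborel {0..} g"
    and moments: "\<And>k. set_integrable lborel {0..} (\<lambda>t. complex_of_real (exp (- t) ^ k) * g t)
        \<and> (LINT t:{0..}|lborel. complex_of_real (exp (- t) ^ k) * g t) = 0"
    and \<phi>: "continuous_on UNIV \<phi>"
  shows "set_integrable lborel {0..} (\<lambda>t. complex_of_real (\<phi> (exp (- t))) * g t)"
    and "(LINT t:{0..}|lborel. complex_of_real (\<phi> (exp (- t))) * g t) = 0"
proof -
  have cont: "continuous_on {0..1} \<phi>" using \<phi> continuous_on_subset by blast
  have "bounded (\<phi> ` {0..1})"
    by (intro compact_imp_bounded compact_continuous_image cont compact_Icc)
  then obtain M where M: "\<And>x. x \<in> {0..1} \<Longrightarrow> \<bar>\<phi> x\<bar> \<le> M" by (metis bounded_iff image_eqI real_norm_def)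
  have e01: "exp (- t) \<in> {0..1}" if "t \<ge> 0" for t :: real using that by simp
  have meas: "(\<lambda>t. \<phi> (exp (- t))) \<in> borel_measurable borel"
    by (intro borel_measurable_continuous_onI continuous_on_compose2[OF \<phi>] continuous_intros) auto
  let ?I = "\<lambda>f. set_lebesgue_integral lborel {0::real..} (f :: real \<Rightarrow> complex)"
  show i: "set_integrable lborel {0..} (\<lambda>t. complex_of_real (\<phi> (exp (- t))) * g t)"
  proof (rule set_integrable_bound)
    show "set_integrable lborel {0..} (\<lambda>t. complex_of_real M * g t)"
      using int by (rule set_integrable_mult_right)
    have "(\<lambda>t. complex_of_real (\<phi> (exp (- t))) * (indicator {0..} t *\<^sub>R g t)) \<in> borel_measurable lborel"
      using int meas unfolding set_integrable_def by measurable
    then show "set_borel_measurable lborel {0..} (\<lambda>t. complex_of_real (\<phi> (exp (- t))) * g t)"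
      unfolding set_borel_measurable_def by (simp add: scaleR_conv_of_real mult_ac)
    show "AE t in lborel. t \<in> {0..} \<longrightarrow>
        norm (complex_of_real (\<phi> (exp (- t))) * g t) \<le> norm (complex_of_real M * g t)"
    proof (intro AE_I2 impI)
      fix t :: real assume "t \<in> {0..}"
      then have "\<bar>\<phi> (exp (- t))\<bar> \<le> \<bar>M\<bar>" using M[OF e01[of t]] by simp
      then show "norm (complex_of_real (\<phi> (exp (- t))) * g t) \<le> norm (complex_of_real M * g t)"
        by (simp add: norm_mult mult_right_mono)
    qed
  qed
  define K where "K = (LINT t:{0..}|lborel. norm (g t))"
  have K: "K \<ge> 0" unfolding K_def set_lebesgue_integral_def by (intro integral_nonneg_AE) auto
  have bound: "norm (?I (\<lambda>t. complex_of_real (\<phi> (exp (- t))) * g t)) \<le> e * K" if "e > 0" for e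
  proof -
    obtain p where p: "real_polynomial_function p" "\<And>x. x \<in> {0..1} \<Longrightarrow> \<bar>\<phi> x - p x\<bar> < e"
      using Stone_Weierstrass_real_polynomial_function[OF compact_Icc cont \<open>e > 0\<close>] by metis
    note P = exp_moments_zero_polynomial[OF moments p(1)]
    let ?d = "\<lambda>t. complex_of_real (\<phi> (exp (- t))) * g t - complex_of_real (p (exp (- t))) * g t"
    have d: "set_integrable lborel {0..} ?d" by (intro set_integral_diff i P)
    have "?I (\<lambda>t. complex_of_real (\<phi> (exp (- t))) * g t) = ?I ?d"
      by (subst set_integral_diff(2)[OF i P(1)]) (simp add: P)
    also have "norm \<dots> \<le> (LINT t:{0..}|lborel. norm (?d t))"
      unfolding set_lebesgue_integral_def
      by (rule order_trans[OF integral_norm_bound]) simp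
    also have "\<dots> \<le> (LINT t:{0..}|lborel. e * norm (g t))"
    proof (rule set_integral_mono)
      show "set_integrable lborel {0..} (\<lambda>t. norm (?d t))" using d by (rule set_integrable_norm)
      show "set_integrable lborel {0..} (\<lambda>t. e * norm (g t))"
        using set_integrable_norm[OF int] by (rule set_integrable_mult_right)
      fix t :: real assume "t \<in> {0..}"
      then have "\<bar>\<phi> (exp (- t)) - p (exp (- t))\<bar> \<le> e" using p(2)[OF e01[of t]] by simp
      then show "norm (?d t) \<le> e * norm (g t)"
        by (simp add: left_diff_distrib[symmetric] norm_mult mult_right_mono flip: of_real_diff)
    qed
    also have "\<dots> = e * K" unfolding K_def by simp
    finally show ?thesis .
  qed
  have "norm (?I (\<lambda>t. complex_of_real (\<phi> (exp (- t))) * g t)) \<le> 0"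
  proof (rule field_le_epsilon)
    fix e :: real assume "e > 0"
    \<comment> \<open>Dividing by \<open>K + 1\<close> rather than \<open>K\<close> also covers
      \<open>K = 0\<close>.\<close>
    then have "norm (?I (\<lambda>t. complex_of_real (\<phi> (exp (- t))) * g t)) \<le> e / (K + 1) * K"
      using K by (intro bound) auto
    also have "\<dots> \<le> 0 + e" using K \<open>e > 0\<close> by (simp add: field_simps)
    finally show "norm (?I (\<lambda>t. complex_of_real (\<phi> (exp (- t))) * g t)) \<le> 0 + e" .
  qed
  then show "?I (\<lambda>t. complex_of_real (\<phi> (exp (- t))) * g t) = 0" by simp
qed

text \<open>By contradiction: once \<open>g\<close> is rotated by \<open>cnj (g t0)\<close>, its
  real part is positive near \<open>t0\<close>, and testing it against a bump there would give a
  positive integral.\<close>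

lemma exp_moments_zero_imp_zero:
  fixes g :: "real \<Rightarrow> complex"
  assumes int: "set_integrable lborel {0..} g"
    and moments: "\<And>k. set_integrable lborel {0..} (\<lambda>t. complex_of_real (exp (- t) ^ k) * g t)
        \<and> (LINT t:{0..}|lborel. complex_of_real (exp (- t) ^ k) * g t) = 0"
    and cont: "continuous_on {0..} g"
    and "t0 \<ge> 0"
  shows "g t0 = 0"
proof (rule ccontr)
  assume nz: "g t0 \<noteq> 0"
  define u where "u t = Re (cnj (g t0) * g t)" for t
  have u0: "u t0 > 0"
    using nz by (simp add: u_def complex_eq_iff sum_squares_gt_zero_iff)
  have "continuous_on {0..} u" unfolding u_def by (intro continuous_intros cont)
  then obtain d where d: "d > 0" "\<And>t. t \<ge> 0 \<Longrightarrow> \<bar>t - t0\<bar> < d \<Longrightarrow> u t > 0"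
    using u0 \<open>t0 \<ge> 0\<close> unfolding continuous_on_iff dist_real_def
    by (metis atLeast_iff abs_diff_less_iff diff_self)
  \<comment> \<open>This is the distance from \<open>exp (- t0)\<close> to
    \<open>exp (- t0 - d)\<close>, the smaller of the gaps to the images of \<open>t0 + d\<close>
    and \<open>t0 - d\<close> because \<open>exp\<close> is convex.\<close>
  define r where "r = exp (- t0) * (1 - exp (- d))"
  have r: "r > 0" using d(1) by (simp add: r_def)
  \<comment> \<open>a bump in the variable \<open>exp (- t)\<close>, supported within distance \<open>d\<close> of \<open>t0\<close>\<close>
  define \<phi> where "\<phi> x = max 0 (r - \<bar>x - exp (- t0)\<bar>)" for x
  have supp: "\<bar>t - t0\<bar> < d" if "\<phi> (exp (- t)) > 0" for t
  proof -
    from that have *: "\<bar>exp (- t) - exp (- t0)\<bar> < r" by (auto simp: \<phi>_def max_def split: if_splits)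
    have "r = exp (- t0) - exp (- t0 - d)"
      by (simp add: r_def right_diff_distrib mult_exp_exp)
    with * have "exp (- t0 - d) < exp (- t)" by linarith
    \<comment> \<open>This inequality says that the upper gap
      \<open>exp (- t0 + d) - exp (- t0)\<close> is at least \<open>r\<close>.\<close>
    moreover have "2 \<le> exp d + exp (- d)"
      using exp_ge_add_one_self[of d] exp_ge_add_one_self[of "- d"] by linarith
    then have "r \<le> exp (- t0) * (exp d - 1)" unfolding r_def by (intro mult_left_mono) auto
    then have "r \<le> exp (- t0 + d) - exp (- t0)"
      by (simp only: right_diff_distrib mult_exp_exp mult_1_right)
    with * have "exp (- t) < exp (- t0 + d)" by linarith
    ultimately show ?thesis unfolding exp_less_cancel_iff by linarith
  qed
  have \<phi>0: "\<phi> x \<ge> 0" for x by (simp add: \<phi>_def)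
  have \<phi>c: "continuous_on UNIV \<phi>" unfolding \<phi>_def by (intro continuous_intros)
  let ?f = "\<lambda>t. complex_of_real (\<phi> (exp (- t))) * g t"
  have F: "set_integrable lborel {0..} (\<lambda>t. cnj (g t0) * ?f t)"
    using exp_moments_zero_continuous(1)[OF int moments \<phi>c] by (rule set_integrable_mult_right)
  have F0: "(LINT t:{0..}|lborel. cnj (g t0) * ?f t) = 0"
    using exp_moments_zero_continuous(2)[OF int moments \<phi>c] by (simp only: set_integral_mult_right) simp
  define v where "v t = indicator {0..} t * (\<phi> (exp (- t)) * u t)" for t
  have v_eq: "v = (\<lambda>t. Re (indicator {0..} t *\<^sub>R (cnj (g t0) * ?f t)))"
    by (auto simp: v_def u_def algebra_simps)
  have v_int: "integrable lborel v"
    using F unfolding v_eq set_integrable_def by (rule integrable_Re)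
  have "integral\<^sup>L lborel v = Re (LINT t:{0..}|lborel. cnj (g t0) * ?f t)"
    using F unfolding v_eq set_integrable_def set_lebesgue_integral_def by (rule integral_Re)
  then have v0: "integral\<^sup>L lborel v = 0" unfolding F0 by simp
  have v_nonneg: "v t \<ge> 0" for t
  proof (cases "t \<ge> 0 \<and> \<phi> (exp (- t)) > 0")
    case True
    then have "u t > 0" using supp d(2) by blast
    with True show ?thesis by (simp add: v_def)
  next
    case False
    then show ?thesis using \<phi>0[of "exp (- t)"] by (auto simp: v_def indicator_def not_less)
  qed
  have "AE t in lborel. v t = 0"
    using integral_nonneg_eq_0_iff_AE[OF v_int] v_nonneg v0 by auto
  then have AE: "AE t in lborel. t \<notin> {t. v t \<noteq> 0}" by simp
  have "isCont (\<lambda>t. r - \<bar>exp (- t) - exp (- t0)\<bar>) t0" by (intro continuous_intros)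
  then have "\<forall>\<^sub>F t in at t0. 0 < r - \<bar>exp (- t) - exp (- t0)\<bar>"
    unfolding isCont_def using r by (intro order_tendstoD(1)[where y="r - \<bar>exp (- t0) - exp (- t0)\<bar>"]) auto
  then obtain e where e: "e > 0" "\<And>t. t \<noteq> t0 \<Longrightarrow> \<bar>t - t0\<bar> < e \<Longrightarrow> 0 < r - \<bar>exp (- t) - exp (- t0)\<bar>"
    unfolding eventually_at dist_real_def by auto
  \<comment> \<open>Only points to the right of \<open>t0\<close> are used, so that
    \<open>t0 = 0\<close> needs no separate case.\<close>
  have "{t0<..<t0 + e} \<subseteq> {t. v t \<noteq> 0}"
  proof
    fix t assume t: "t \<in> {t0<..<t0 + e}"
    then have "\<phi> (exp (- t)) > 0" using e(2)[of t] by (auto simp: \<phi>_def)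
    moreover from this have "u t > 0" using t \<open>t0 \<ge> 0\<close> by (intro d(2) supp) auto
    ultimately show "t \<in> {t. v t \<noteq> 0}" using t \<open>t0 \<ge> 0\<close> by (simp add: v_def)
  qed
  with AE have "AE t in lborel. t \<notin> {t0<..<t0 + e}" by (auto elim!: eventually_mono)
  then have "emeasure lborel {t0<..<t0 + e} = 0"
    by (subst (asm) AE_iff_measurable[where N="{t0<..<t0+e}"]) auto
  with e(1) show False by simp
qed

text \<open>Lerch's theorem: on the real half-line of transform parameters \<open>s0 + k\<close>, the difference of two
  inverse transforms, damped by \<open>exp (- s0 t)\<close>, has vanishing moments in the variable \<open>exp (- t)\<close>.\<close>

lemma is_inverse_laplace_unique:
  assumes "is_inverse_laplace F h1" "is_inverse_laplace F h2"
  shows "h1 = h2"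
proof -
  let ?e = "\<lambda>s t. exp (- (s * complex_of_real t))"
  obtain s1 where s1: "\<And>s. s1 < Re s \<Longrightarrow> set_integrable lborel {0..} (\<lambda>t. ?e s t * h1 t)"
      "\<And>s. s1 < Re s \<Longrightarrow> (LINT t:{0..}|lborel. ?e s t * h1 t) = F s"
    using assms(1) unfolding is_inverse_laplace_def by blast
  obtain s2 where s2: "\<And>s. s2 < Re s \<Longrightarrow> set_integrable lborel {0..} (\<lambda>t. ?e s t * h2 t)"
      "\<And>s. s2 < Re s \<Longrightarrow> (LINT t:{0..}|lborel. ?e s t * h2 t) = F s"
    using assms(2) unfolding is_inverse_laplace_def by blast
  \<comment> \<open>The added 1 puts even \<open>s0\<close> itself beyond both abscissas, so that
    \<open>g\<close> is integrable: this is the moment \<open>k = 0\<close>.\<close>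
  define s0 where "s0 = complex_of_real (max s1 s2 + 1)"
  define g where "g t = ?e s0 t * (h1 t - h2 t)" for t
  have moment: "set_integrable lborel {0..} (\<lambda>t. complex_of_real (exp (- t) ^ k) * g t)
      \<and> (LINT t:{0..}|lborel. complex_of_real (exp (- t) ^ k) * g t) = 0" for k
  proof -
    have e: "complex_of_real (exp (- t) ^ k) * ?e s0 t = ?e (s0 + of_nat k) t" for t
    proof -
      have "complex_of_real (exp (- t) ^ k) = exp (- (of_nat k * complex_of_real t))"
        by (simp add: exp_of_real[symmetric] flip: exp_of_nat_mult)
      then show ?thesis by (simp only: mult_exp_exp) (simp add: algebra_simps)
    qed
    have eq: "complex_of_real (exp (- t) ^ k) * g t
        = ?e (s0 + of_nat k) t * h1 t - ?e (s0 + of_nat k) t * h2 t" for t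
      unfolding g_def mult.assoc[symmetric] e by (simp add: algebra_simps)
    have s: "s1 < Re (s0 + of_nat k)" "s2 < Re (s0 + of_nat k)" by (auto simp: s0_def)
    show ?thesis
      unfolding eq using set_integral_diff[OF s1(1)[OF s(1)] s2(1)[OF s(2)]] s1(2)[OF s(1)] s2(2)[OF s(2)]
      by simp
  qed
  have "g t = 0" if "t \<ge> 0" for t
  proof (rule exp_moments_zero_imp_zero[OF _ moment _ that])
    show "set_integrable lborel {0..} g" using moment[of 0] by simp
    show "continuous_on {0..} g"
      using assms unfolding g_def is_inverse_laplace_def by (intro continuous_intros) auto
  qed
  then have "h1 t = h2 t" if "t \<ge> 0" for t using that by (simp add: g_def)
  moreover have "h1 t = h2 t" if "t < 0" for t using assms that by (simp add: is_inverse_laplace_def)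
  ultimately show ?thesis by (metis ext linorder_not_less)
qed

lemma inverse_laplace_eqI: "is_inverse_laplace F h \<Longrightarrow> inverse_laplace F = h"
  unfolding inverse_laplace_def using is_inverse_laplace_unique by blast

section \<open>Resolvents of Jordan blocks\<close>

text \<open>The entries on the \<open>k\<close>-th superdiagonal of \<open>exp (- t J)\<close>, for an upper Jordan block \<open>J\<close> with
  eigenvalue \<open>l\<close>.\<close>

definition jordan_exp :: "complex \<Rightarrow> nat \<Rightarrow> real \<Rightarrow> complex" where
  "jordan_exp l k t = (- 1) ^ k / fact k * (complex_of_real t ^ k * exp (- (l * complex_of_real t)))"

text \<open>Conjugating one factor turns its rate into \<open>cnj l\<close>, the rates add up, and
  the powers of t merge into \<open>t ^ (k + j)\<close>, whose integral supplies the factorial in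
  the numerator.\<close>

lemma set_integral_jordan_exp:
  assumes "Re (cnj l + m) > 0"
  shows "set_integrable lborel {0..} (\<lambda>t. cnj (jordan_exp l j t) * jordan_exp m k t)"
    and "(LINT t:{0..}|lborel. cnj (jordan_exp l j t) * jordan_exp m k t)
      = (- 1) ^ (k + j) * (fact (k + j) / (fact k * fact j)) / (cnj l + m) ^ (k + j + 1)"
proof -
  have eq: "cnj (jordan_exp l j t) * jordan_exp m k t
      = ((- 1) ^ (k + j) / (fact k * fact j)) * (complex_of_real t ^ (k + j) * exp (- ((cnj l + m) * complex_of_real t)))" for t
  proof -
    have "exp (- ((cnj l + m) * complex_of_real t))
        = cnj (exp (- (l * complex_of_real t))) * exp (- (m * complex_of_real t))"
      unfolding exp_cnj mult_exp_exp by (simp add: algebra_simps)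
    then show ?thesis by (simp add: jordan_exp_def power_add mult_ac)
  qed
  show "set_integrable lborel {0..} (\<lambda>t. cnj (jordan_exp l j t) * jordan_exp m k t)"
    unfolding eq using set_integrable_power_exp[OF assms] by (rule set_integrable_mult_right)
  show "(LINT t:{0..}|lborel. cnj (jordan_exp l j t) * jordan_exp m k t)
      = (- 1) ^ (k + j) * (fact (k + j) / (fact k * fact j)) / (cnj l + m) ^ (k + j + 1)"
    unfolding eq set_integral_mult_right set_integral_power_exp[OF assms] by simp
qed

text \<open>\<open>F\<close> is prescribed only where \<open>Re (s + l) > 0\<close>, the half-plane
  in which the integral converges; there \<open>H_tilde\<close> has its closed form. No sign of
  \<open>Re l\<close> is assumed, as the definition lets the abscissa be any real number.\<close>

lemma is_inverse_laplace_jordan_exp: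
  assumes F: "\<And>s. - Re l < Re s \<Longrightarrow> F s = (- 1) ^ k / (s + l) ^ Suc k"
  shows "is_inverse_laplace F (\<lambda>t. if t < 0 then 0 else jordan_exp l k t)"
  unfolding is_inverse_laplace_def
proof (intro conjI exI[of _ "- Re l"] allI impI)
  have "continuous_on {0..} (jordan_exp l k)"
    unfolding jordan_exp_def by (intro continuous_intros)
  then show "continuous_on {0..} (\<lambda>t. if t < 0 then 0 else jordan_exp l k t)"
    by (rule continuous_on_eq) auto
next
  fix s assume s: "- Re l < Re s"
  then have pos: "Re (s + l) > 0" by simp
  have eq: "exp (- (s * complex_of_real t)) * jordan_exp l k t
      = ((- 1) ^ k / fact k) * (complex_of_real t ^ k * exp (- ((s + l) * complex_of_real t)))" for t
    by (simp add: jordan_exp_def exp_add[symmetric] ring_distribs)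
  have cong: "set_integrable lborel {0..} (\<lambda>t. exp (- (s * complex_of_real t)) * (if t < 0 then 0 else jordan_exp l k t))
      = set_integrable lborel {0..} (\<lambda>t. exp (- (s * complex_of_real t)) * jordan_exp l k t)"
    "(LINT t:{0..}|lborel. exp (- (s * complex_of_real t)) * (if t < 0 then 0 else jordan_exp l k t))
      = (LINT t:{0..}|lborel. exp (- (s * complex_of_real t)) * jordan_exp l k t)"
    by (rule set_integrable_cong, auto) (rule set_lebesgue_integral_cong, auto)
  show "set_integrable lborel {0..} (\<lambda>t. exp (- (s * complex_of_real t)) * (if t < 0 then 0 else jordan_exp l k t))"
    unfolding cong eq using set_integrable_power_exp[OF pos] by (rule set_integrable_mult_right)
  show "(LINT t:{0..}|lborel. exp (- (s * complex_of_real t)) * (if t < 0 then 0 else jordan_exp l k t)) = F s"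
    unfolding cong eq set_integral_mult_right set_integral_power_exp[OF pos] F[OF s] by simp
qed auto

text \<open>With \<open>c = s + l\<close> and \<open>S\<close> the nilpotent shift, the matrix is
  \<open>c I + S\<close>, and the entries are those of the Neumann series with terms
  \<open>(- S)^d / c^(d + 1)\<close>, which ends after \<open>N\<close> terms.\<close>

lemma jordan_block_resolvent_inverse:
  fixes l s :: complex
  assumes nz: "s + l \<noteq> 0"
  shows "(s \<cdot>\<^sub>m 1\<^sub>m N + jordan_block N l)
      * mat N N (\<lambda>(i, j). if i \<le> j then (- 1) ^ (j - i) / (s + l) ^ Suc (j - i) else 0) = 1\<^sub>m N"
    (is "?A * ?X = _")
proof (rule eq_matI)
  fix i j assume ij: "i < dim_row (1\<^sub>m N :: complex mat)" "j < dim_col (1\<^sub>m N :: complex mat)"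
  let ?x = "\<lambda>i j. if i \<le> j then (- 1) ^ (j - i) / (s + l) ^ Suc (j - i) else 0"
  have "(?A * ?X) $$ (i, j) = (\<Sum>m<N. (s \<cdot>\<^sub>m 1\<^sub>m N + jordan_block N l) $$ (i, m) * ?x m j)"
    using ij by (auto simp: scalar_prod_def atLeast0LessThan intro!: sum.cong)
  also have "\<dots> = (\<Sum>m<N. (if m = i then (s + l) * ?x i j else 0) + (if m = Suc i then ?x (Suc i) j else 0))"
    using ij by (intro sum.cong) (auto simp: jordan_block_def)
  also have "\<dots> = (s + l) * ?x i j + (if Suc i < N then ?x (Suc i) j else 0)"
    using ij by (simp add: sum.distrib)
  also have "\<dots> = (1\<^sub>m N :: complex mat) $$ (i, j)"
  proof (cases "i < j")
    case True
    \<comment> \<open>Above the diagonal the two remaining terms are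
      \<open>(- 1)^(d + 1) / c^(d + 1)\<close> and \<open>(- 1)^d / c^(d + 1)\<close>, which
      cancel.\<close>
    then obtain d where "j = Suc (i + d)" using less_imp_Suc_add by blast
    moreover define c where "c = s + l"
    ultimately show ?thesis using ij nz unfolding c_def[symmetric] by (simp add: field_simps)
  qed (use ij nz in auto)
  finally show "(?A * ?X) $$ (i, j) = (1\<^sub>m N :: complex mat) $$ (i, j)" .
qed auto

text \<open>\<open>mat_inverse\<close> is an algorithm known through its outcome: the existence of
  \<open>X\<close> rules out \<open>None\<close>, and uniqueness of inverses identifies the returned
  matrix.\<close>

lemma mat_inverse_eqI:
  fixes A X :: "'a::field mat"
  assumes A: "A \<in> carrier_mat N N" and X: "X \<in> carrier_mat N N" and AX: "A * X = 1\<^sub>m N"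
  shows "mat_inverse A = Some X"
proof (cases "mat_inverse A")
  case None
  have "X * A = 1\<^sub>m N" using mat_mult_left_right_inverse[OF A X AX] .
  then have "A \<in> Units (ring_mat TYPE('a) N ())"
    using A X AX unfolding Units_def ring_mat_def by auto
  with mat_inverse(1)[OF A None, of "()"] show ?thesis by simp
next
  case (Some Y)
  from mat_inverse(2)[OF A this] have Y: "Y * A = 1\<^sub>m N" "Y \<in> carrier_mat N N" by auto
  have "Y = Y * (A * X)" using Y AX by simp
  also have "\<dots> = (Y * A) * X" using Y(2) A X by (simp add: assoc_mult_mat)
  also have "\<dots> = X" using Y X by simp
  finally show ?thesis using Some by simp
qed

lemma H_tilde_entry:
  assumes "s + block_eigenvalue bs k \<noteq> 0" "p \<le> q" "q < block_size bs k"
  shows "H_tilde bs k s $$ (p, q) = (- 1) ^ (q - p) / (s + block_eigenvalue bs k) ^ Suc (q - p)"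
  using mat_inverse_eqI[OF _ _ jordan_block_resolvent_inverse[OF assms(1)], of "block_size bs k"] assms(2,3)
  by (simp add: H_tilde_def)

lemma h_tilde_eq:
  assumes "p \<le> q" "q < block_size bs k"
  shows "h_tilde bs k p q = (\<lambda>t. if t < 0 then 0 else jordan_exp (block_eigenvalue bs k) (q - p) t)"
  unfolding h_tilde_def
proof (intro inverse_laplace_eqI is_inverse_laplace_jordan_exp)
  fix s assume "- Re (block_eigenvalue bs k) < Re s"
  then have "s + block_eigenvalue bs k \<noteq> 0"
    by (metis add.commute add_eq_0_iff less_irrefl uminus_complex.sel(1))
  then show "H_tilde bs k s $$ (p, q) = (- 1) ^ (q - p) / (s + block_eigenvalue bs k) ^ Suc (q - p)"
    using assms by (rule H_tilde_entry)
qed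

lemma L2_inner_h_tilde:
  assumes "p \<le> q" "q < block_size bs k" "a \<le> b" "b < block_size bs l"
  shows "L2_inner (h_tilde bs l a b) (h_tilde bs k p q)
    = (LINT t:{0..}|lborel. cnj (jordan_exp (block_eigenvalue bs k) (q - p) t)
        * jordan_exp (block_eigenvalue bs l) (b - a) t)"
  unfolding L2_inner_def h_tilde_eq[OF assms(1,2)] h_tilde_eq[OF assms(3,4)]
  by (rule set_lebesgue_integral_cong) auto

section \<open>Eigenfunctions of the Laplacian\<close>

text \<open>The degree on the diagonal is spread over the differences \<open>v i - v j\<close>, so
  that a shift of \<open>v\<close> by a constant visibly leaves the right-hand side unchanged;
  \<open>v = 0\<close> is allowed.\<close>

definition laplacian_eigenfunction :: "nat \<Rightarrow> (nat \<Rightarrow> nat \<Rightarrow> real) \<Rightarrow> complex \<Rightarrow> (nat \<Rightarrow> complex) \<Rightarrow> bool" where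
  "laplacian_eigenfunction n b l v \<longleftrightarrow> (\<forall>i<n. l * v i = (\<Sum>j<n. complex_of_real (b i j) * (v i - v j)))"

lemma laplacian_mult_vec:
  assumes "i < n" "weighted_digraph n b" "v \<in> carrier_vec n"
  shows "(complex_mat (laplacian n b) *\<^sub>v v) $ i = (\<Sum>j<n. complex_of_real (b i j) * (v $ i - v $ j))"
proof -
  have bii: "b i i = 0" using assms by (simp add: weighted_digraph_def)
  have "(complex_mat (laplacian n b) *\<^sub>v v) $ i
      = (\<Sum>j<n. complex_of_real (if i = j then (\<Sum>k<n. b i k) else - b i j) * v $ j)"
    using assms by (simp add: laplacian_def scalar_prod_def atLeast0LessThan)
  \<comment> \<open>The absence of self-loops makes both forms agree at \<open>j = i\<close>, where
    the extra term \<open>- b i i\<close> is 0.\<close>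
  also have "\<dots> = (\<Sum>j<n. (if j = i then complex_of_real (\<Sum>k<n. b i k) * v $ i else 0)
      + (- complex_of_real (b i j) * v $ j))"
    by (rule sum.cong) (auto simp: bii)
  also have "\<dots> = (\<Sum>j<n. complex_of_real (b i j) * (v $ i - v $ j))"
    using assms(1) by (simp add: sum.distrib sum_distrib_right sum_subtractf sum_negf right_diff_distrib)
  finally show ?thesis .
qed

text \<open>Maximum modulus principle: at a node where the modulus is maximal, the real part of
  \<open>cnj (v i)\<close> times the eigenvalue equation is a sum of nonnegative terms.\<close>

lemma laplacian_max_modulus_step:
  assumes G: "weighted_digraph n b" and v: "laplacian_eigenfunction n b l v" and l: "Re l \<le> 0"
    and i: "i < n" and max: "\<And>j. j < n \<Longrightarrow> cmod (v j) \<le> cmod (v i)"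
  shows "l * v i = 0" and "\<And>j. j < n \<Longrightarrow> b i j > 0 \<Longrightarrow> v j = v i"
proof -
  let ?T = "\<lambda>j. b i j * ((cmod (v i))\<^sup>2 - Re (cnj (v i) * v j))"
  have T: "?T j \<ge> 0" if "j < n" for j
  proof -
    have "Re (cnj (v i) * v j) \<le> cmod (v i) * cmod (v j)"
      by (metis complex_Re_le_cmod complex_mod_cnj norm_mult)
    also have "\<dots> \<le> (cmod (v i))\<^sup>2"
      using max[OF that] by (simp add: power2_eq_square mult_left_mono)
    finally show ?thesis using G i that by (auto simp: weighted_digraph_def)
  qed
  have "Re l * (cmod (v i))\<^sup>2 = Re (cnj (v i) * (l * v i))"
    by (simp add: cmod_power2) (simp add: power2_eq_square algebra_simps)
  also have "\<dots> = Re (\<Sum>j<n. cnj (v i) * (complex_of_real (b i j) * (v i - v j)))"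
    using v i by (simp add: laplacian_eigenfunction_def sum_distrib_left)
  also have "\<dots> = (\<Sum>j<n. ?T j)"
    unfolding Re_sum
    by (intro sum.cong refl) (simp add: cmod_power2, simp add: power2_eq_square algebra_simps)
  finally have sum: "Re l * (cmod (v i))\<^sup>2 = (\<Sum>j<n. ?T j)" .
  \<comment> \<open>The left-hand side of \<open>sum\<close> is at most 0 because
    \<open>Re l \<le> 0\<close>, while the right-hand side is at least 0.\<close>
  have "(\<Sum>j<n. ?T j) = 0"
    using sum_nonneg[of "{..<n}" ?T] T sum l mult_nonpos_nonneg[OF l, of "(cmod (v i))\<^sup>2"] by fastforce
  then have T0: "?T j = 0" if "j < n" for j
    using T that by (subst (asm) sum_nonneg_eq_0_iff) auto
  show step: "v j = v i" if "j < n" "b i j > 0" for j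
  proof -
    have re: "Re (cnj (v i) * v j) = (cmod (v i))\<^sup>2" using T0[OF that(1)] that(2) by simp
    \<comment> \<open>Equality in the bound on the real part forces equality of the numbers: by the
      law of cosines the squared distance is \<open>(cmod (v j))^2 - (cmod (v i))^2\<close>, which
      is at most 0.\<close>
    have "(cmod (v j - v i))\<^sup>2 = (cmod (v j))\<^sup>2 + (cmod (v i))\<^sup>2 - 2 * Re (cnj (v i) * v j)"
      by (simp add: cmod_power2) (simp add: power2_eq_square algebra_simps)
    also have "\<dots> \<le> 0"
      unfolding re using power_mono[OF max[OF that(1)], of 2] by simp
    finally show ?thesis by simp
  qed
  have "l * v i = (\<Sum>j<n. complex_of_real (b i j) * (v i - v j))"
    using v i by (simp add: laplacian_eigenfunction_def)
  also have "\<dots> = 0"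
  proof (intro sum.neutral ballI)
    fix j assume "j \<in> {..<n}"
    then have "j < n" by simp
    moreover have "b i j \<ge> 0" using G i \<open>j < n\<close> by (simp add: weighted_digraph_def)
    ultimately show "complex_of_real (b i j) * (v i - v j) = 0"
      using step[of j] by (cases "b i j = 0") auto
  qed
  finally show "l * v i = 0" .
qed

text \<open>A node \<open>m\<close> of maximal modulus passes its value on to its out-neighbours,
  which are then maximal too; following a path to \<open>r\<close> gives
  \<open>v r = v m\<close>.\<close>

lemma laplacian_max_modulus:
  assumes G: "weighted_digraph n b" and r: "globally_reachable n b r"
    and v: "laplacian_eigenfunction n b l v" and l: "Re l \<le> 0" and i: "i < n"
  shows "cmod (v i) \<le> cmod (v r)" and "l * v r = 0"
proof -
  have ne: "(\<lambda>j. cmod (v j)) ` {..<n} \<noteq> {}" "finite ((\<lambda>j. cmod (v j)) ` {..<n})" using i by auto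
  then obtain m where m: "m < n" "cmod (v m) = Max ((\<lambda>j. cmod (v j)) ` {..<n})"
    using Max_in by (metis (no_types, lifting) imageE lessThan_iff)
  have max: "cmod (v j) \<le> cmod (v m)" if "j < n" for j
    unfolding m(2) using ne(2) that by (intro Max_ge) auto
  have "(m, r) \<in> (graph_edges n b)\<^sup>*" using r m(1) by (simp add: globally_reachable_def)
  then have "v r = v m"
  proof (induction rule: rtrancl_induct)
    case (step j k)
    then have "j < n" "k < n" "b j k > 0" by (auto simp: graph_edges_def)
    then show ?case
      using laplacian_max_modulus_step(2)[OF G v l \<open>j < n\<close>] max step.IH by metis
  qed simp
  then show "cmod (v i) \<le> cmod (v r)" "l * v r = 0"
    using max[OF i] laplacian_max_modulus_step(1)[OF G v l m(1) max] by auto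
qed

text \<open>For \<open>l = 0\<close> the shifted function \<open>v - v r\<close> is again an
  eigenfunction and vanishes at \<open>r\<close>, where its modulus is largest; for
  \<open>l \<noteq> 0\<close> already \<open>v r = 0\<close>, so that \<open>v\<close> is zero on
  all nodes.\<close>

lemma laplacian_eigenfunction_const:
  assumes G: "weighted_digraph n b" and r: "globally_reachable n b r"
    and v: "laplacian_eigenfunction n b l v" and l: "Re l \<le> 0"
  shows "\<forall>i<n. v i = v r"
proof (cases "l = 0")
  case True
  let ?u = "\<lambda>i. v i - v r"
  have "laplacian_eigenfunction n b l ?u"
    using v True by (simp add: laplacian_eigenfunction_def)
  from laplacian_max_modulus(1)[OF G r this l] show ?thesis by simp
next
  case False
  then have "v r = 0" using laplacian_max_modulus(2)[OF G r v l] r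
    by (auto simp: globally_reachable_def)
  then show ?thesis using laplacian_max_modulus(1)[OF G r v l] by simp
qed

section \<open>Block indices and Jordan matrices\<close>

lemma block_offset_0 [simp]: "block_offset ns 0 = 0"
  by (simp add: block_offset_def)

lemma block_offset_Cons_Suc [simp]: "block_offset (a # ns) (Suc k) = a + block_offset ns k"
  by (simp add: block_offset_def)

lemma block_offset_Suc: "k < length ns \<Longrightarrow> block_offset ns (Suc k) = block_offset ns k + ns ! k"
  by (simp add: block_offset_def take_Suc_conv_app_nth)

lemma block_offset_mono: "j \<le> k \<Longrightarrow> block_offset ns j \<le> block_offset ns k"
proof (induction rule: dec_induct)
  case (step m)
  \<comment> \<open>Past the end of the list \<open>take\<close> adds nothing and the offset stays
    constant.\<close>
  have "block_offset ns m \<le> block_offset ns (Suc m)"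
    by (cases "m < length ns") (simp_all add: block_offset_Suc, simp add: block_offset_def)
  with step show ?case by simp
qed simp

lemma block_offset_add_less:
  assumes "k < length ns" "p < ns ! k"
  shows "block_offset ns k + p < sum_list ns"
proof -
  have "block_offset ns k + p < block_offset ns (Suc k)" using assms by (simp add: block_offset_Suc)
  also have "\<dots> \<le> block_offset ns (length ns)" using assms(1) by (intro block_offset_mono) simp
  finally show ?thesis by (simp add: block_offset_def)
qed

lemma block_of_offset:
  assumes "k < length ns" "p < ns ! k"
  shows "block_of ns (block_offset ns k + p) = k"
  unfolding block_of_def
proof (rule Least_equality)
  show "block_offset ns k + p < block_offset ns (Suc k)" using assms by (simp add: block_offset_Suc)
next
  fix j assume "block_offset ns k + p < block_offset ns (Suc j)"
  then have "\<not> block_offset ns (Suc j) \<le> block_offset ns k" by simp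
  then show "k \<le> j" using block_offset_mono[of "Suc j" k ns] by (meson not_less_eq_eq)
qed

lemma block_index_cases:
  assumes "i < sum_list ns"
  obtains k p where "k < length ns" "p < ns ! k" "i = block_offset ns k + p"
  using assms
proof (induction ns arbitrary: i thesis)
  case (Cons a ns)
  show ?case
  proof (cases "i < a")
    case True
    with Cons.prems(1)[of 0 i] show ?thesis by simp
  next
    case False
    then have "i - a < sum_list ns" using Cons.prems(2) by simp
    then obtain k p where "k < length ns" "p < ns ! k" "i - a = block_offset ns k + p"
      using Cons.IH by blast
    with False Cons.prems(1)[of "Suc k" p] show ?thesis by simp
  qed
qed simp

lemma sum_blocks:
  fixes f :: "nat \<Rightarrow> 'a::comm_monoid_add"
  shows "(\<Sum>i<sum_list ns. f i) = (\<Sum>k<length ns. \<Sum>p<ns ! k. f (block_offset ns k + p))"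
proof (induction ns arbitrary: f)
  case (Cons a ns)
  have "(\<Sum>i<sum_list (a # ns). f i) = (\<Sum>i<a. f i) + (\<Sum>i=a..<a + sum_list ns. f i)"
    by (simp add: lessThan_atLeast0 sum.atLeastLessThan_concat)
  also have "(\<Sum>i=a..<a + sum_list ns. f i) = (\<Sum>i<sum_list ns. f (a + i))"
    using sum.shift_bounds_nat_ivl[of f 0 a "sum_list ns"]
    by (simp add: lessThan_atLeast0 add.commute)
  finally show ?case
    unfolding length_Cons sum.lessThan_Suc_shift using Cons.IH[of "\<lambda>i. f (a + i)"]
    by (simp add: add.assoc)
qed simp

lemma block_mat_entry:
  assumes "k < length ns" "q < ns ! k" "l < length ns" "b < ns ! l"
  shows "block_mat ns B $$ (block_offset ns k + q, block_offset ns l + b) = B k l $$ (q, b)"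
  using assms block_offset_add_less[OF assms(1,2)] block_offset_add_less[OF assms(3,4)]
  by (simp add: block_mat_def block_of_offset Let_def)

lemma jordan_matrix_Cons:
  "jordan_matrix ((N, a) # bs) = four_block_mat (jordan_block N a) (0\<^sub>m N (sum_list (map fst bs)))
     (0\<^sub>m (sum_list (map fst bs)) N) (jordan_matrix bs)"
  by (simp add: jordan_matrix_def[of "_ # _"] Let_def jordan_matrix_def[symmetric])

text \<open>Rows are addressed by block and position, columns globally. The block structure shows
  only in the last row of a block, where the 1 to the right of the diagonal is missing.\<close>

lemma jordan_matrix_entry:
  fixes bs :: "(nat \<times> complex) list"
  assumes "k < length bs" "p < block_size bs k" "j < sum_list (map fst bs)"
  shows "jordan_matrix bs $$ (block_offset (map fst bs) k + p, j)
    = (if j = block_offset (map fst bs) k + p then block_eigenvalue bs k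
       else if Suc p < block_size bs k \<and> j = Suc (block_offset (map fst bs) k + p) then 1 else 0)"
  using assms
proof (induction bs arbitrary: k j)
  case (Cons x bs)
  obtain N a where x: "x = (N, a)" by (cases x)
  show ?case
  proof (cases k)
    case 0
    then show ?thesis using Cons.prems
      by (auto simp: x jordan_matrix_Cons block_size_def block_eigenvalue_def jordan_block_def)
  next
    case (Suc m)
    have m: "m < length bs" "p < block_size bs m" using Cons.prems by (auto simp: Suc block_size_def)
    define o' where "o' = block_offset (map fst bs) m + p"
    have o': "o' < sum_list (map fst bs)"
      unfolding o'_def using m by (intro block_offset_add_less) (auto simp: block_size_def)
    have IH: "jordan_matrix bs $$ (o', i) = (if i = o' then block_eigenvalue bs m
        else if Suc p < block_size bs m \<and> i = Suc o' then 1 else 0)" if "i < sum_list (map fst bs)" for i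
      unfolding o'_def by (rule Cons.IH[OF m that])
    have eqs: "block_offset (map fst (x # bs)) k + p = N + o'"
      "block_size (x # bs) k = block_size bs m" "block_eigenvalue (x # bs) k = block_eigenvalue bs m"
      by (simp_all add: x Suc o'_def block_size_def block_eigenvalue_def)
    have j: "j < N + sum_list (map fst bs)" using Cons.prems(3) by (simp add: x)
    show ?thesis
    proof (cases "j < N")
      case True
      then show ?thesis unfolding eqs using o' j by (simp add: x jordan_matrix_Cons)
    next
      case False
      then obtain i where i: "j = N + i" using le_Suc_ex by (metis not_less)
      then show ?thesis unfolding eqs using o' j IH[of i] by (simp add: x jordan_matrix_Cons)
    qed
  qed
qed simp

lemma jordan_matrix_mult_vec:
  fixes bs :: "(nat \<times> complex) list"
  assumes k: "k < length bs" and p: "p < block_size bs k" and v: "v \<in> carrier_vec (sum_list (map fst bs))"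
  defines "i \<equiv> block_offset (map fst bs) k + p"
  shows "(jordan_matrix bs *\<^sub>v v) $ i
    = block_eigenvalue bs k * v $ i + (if Suc p < block_size bs k then v $ Suc i else 0)"
proof -
  let ?n = "sum_list (map fst bs)"
  have i: "i < ?n" unfolding i_def using k p by (intro block_offset_add_less) (auto simp: block_size_def)
  have Si: "Suc i < ?n" if "Suc p < block_size bs k"
    using block_offset_add_less[of k "map fst bs" "Suc p"] that k by (simp add: i_def block_size_def)
  have "(jordan_matrix bs *\<^sub>v v) $ i = (\<Sum>j<?n. jordan_matrix bs $$ (i, j) * v $ j)"
    using i v by (simp add: scalar_prod_def atLeast0LessThan)
  also have "\<dots> = (\<Sum>j<?n. (if j = i then block_eigenvalue bs k * v $ i else 0)
      + (if j = Suc i then (if Suc p < block_size bs k then v $ Suc i else 0) else 0))"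
    unfolding i_def by (intro sum.cong refl) (auto simp: jordan_matrix_entry[OF k p])
  also have "\<dots> = block_eigenvalue bs k * v $ i + (if Suc p < block_size bs k then v $ Suc i else 0)"
    using i Si by (simp add: sum.distrib)
  finally show ?thesis .
qed

text \<open>This makes the head of a Jordan chain a genuine eigenvector: an off-diagonal 1 in its
  column would stand in the row just above, which is the last row of an earlier block and has
  none.\<close>

lemma jordan_matrix_first_column:
  fixes bs :: "(nat \<times> complex) list"
  assumes k: "k < length bs" and pos: "0 < block_size bs k" and i: "i < sum_list (map fst bs)"
  shows "jordan_matrix bs $$ (i, block_offset (map fst bs) k)
    = (if i = block_offset (map fst bs) k then block_eigenvalue bs k else 0)"
proof -
  let ?ns = "map fst bs"
  obtain m p where m: "m < length bs" "p < block_size bs m" "i = block_offset ?ns m + p"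
    using block_index_cases[OF i] by (auto simp: block_size_def)
  have bound: "block_offset ?ns k < sum_list ?ns"
    using block_offset_add_less[of k ?ns 0] k pos by (simp add: block_size_def)
  have b: "block_of ?ns (block_offset ?ns k) = k"
    using block_of_offset[of k ?ns 0] k pos by (simp add: block_size_def)
  have "block_offset ?ns k \<noteq> Suc (block_offset ?ns m + p)" if "Suc p < block_size bs m"
  proof
    assume eq: "block_offset ?ns k = Suc (block_offset ?ns m + p)"
    then have "block_of ?ns (block_offset ?ns k) = m"
      using block_of_offset[of m ?ns "Suc p"] that m(1) by (simp add: block_size_def)
    with b eq show False by simp
  qed
  moreover have "k = m" if "block_offset ?ns k = block_offset ?ns m + p"
    using that b block_of_offset[of m ?ns p] m by (simp add: block_size_def)
  ultimately show ?thesis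
    unfolding m(3) jordan_matrix_entry[OF m(1,2) bound] by auto
qed

lemma sum_triangle_swap:
  fixes f :: "nat \<Rightarrow> nat \<Rightarrow> 'a::comm_monoid_add"
  shows "(\<Sum>p<N. \<Sum>q=p..<N. f p q) = (\<Sum>q<N. \<Sum>p\<le>q. f p q)"
proof -
  have "(\<Sum>p<N. \<Sum>q=p..<N. f p q) = (\<Sum>p<N. \<Sum>q\<in>{q \<in> {..<N}. p \<le> q}. f p q)"
    by (intro sum.cong) auto
  also have "\<dots> = (\<Sum>q<N. \<Sum>p\<in>{p \<in> {..<N}. p \<le> q}. f p q)"
    by (rule sum.swap_restrict) auto
  also have "\<dots> = (\<Sum>q<N. \<Sum>p\<le>q. f p q)"
    by (intro sum.cong) auto
  finally show ?thesis .
qed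

section \<open>Impulse responses and Jordan chains\<close>

text \<open>The Dirac term contributes \<open>w\<close> to every half-line that reaches 0, and the
  integral may start at 0 since \<open>x\<close> vanishes before. Regularity then bootstraps:
  \<open>x\<close> is an indefinite integral, hence continuous, hence the integrand is continuous
  and \<open>x\<close> is differentiable, one-sidedly at the jump.\<close>

lemma impulse_response_initial_value_problem:
  assumes A: "A \<in> carrier_mat n n" and w: "w \<in> carrier_vec n" and x: "impulse_response A w x"
  shows "x 0 = w"
    and "t \<ge> 0 \<Longrightarrow> i < n \<Longrightarrow>
      ((\<lambda>t. x t $ i) has_vector_derivative (A *\<^sub>v x t) $ i) (at t within {0..})"
proof -
  have dimw: "dim_vec w = n" using w by simp
  have xc: "x t \<in> carrier_vec n" for t using x by (simp add: impulse_response_def dimw)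
  have neg: "(A *\<^sub>v x u) $ i = 0" if "u < 0" "i < n" for u i
    using x that A by (simp add: impulse_response_def dimw)
  have int: "set_integrable lborel {0..t} (\<lambda>u. (A *\<^sub>v x u) $ i)" if "i < n" for i t
    by (rule set_integrable_subset[where A="{..t}"])
       (use x that in \<open>auto simp: impulse_response_def dimw\<close>)
  have x_eq: "x t $ i = integral {0..t} (\<lambda>u. (A *\<^sub>v x u) $ i) + w $ i" if "t \<ge> 0" "i < n" for t i
  proof -
    have "x t $ i = (LINT u:{..t}|lborel. (A *\<^sub>v x u) $ i) + w $ i * measure (return borel 0) {..t}"
      using x that by (simp add: impulse_response_def dimw)
    also have "(LINT u:{..t}|lborel. (A *\<^sub>v x u) $ i) = (LINT u:{0..t}|lborel. (A *\<^sub>v x u) $ i)"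
      unfolding set_lebesgue_integral_def
      by (intro Bochner_Integration.integral_cong refl) (auto simp: indicator_def neg[OF _ \<open>i < n\<close>])
    also have "\<dots> = integral {0..t} (\<lambda>u. (A *\<^sub>v x u) $ i)"
      by (rule set_borel_integral_eq_integral(2)[OF int[OF \<open>i < n\<close>]])
    also have "measure (return borel 0) {..t} = 1"
      using that by (simp add: measure_return)
    finally show ?thesis by simp
  qed
  show "x 0 = w"
    using xc[of 0] w x_eq[of 0] by (intro eq_vecI) auto
  have cont_x: "continuous_on {0..T} (\<lambda>t. x t $ i)" if "i < n" for i T
  proof -
    have "continuous_on {0..T} (\<lambda>t. integral {0..t} (\<lambda>u. (A *\<^sub>v x u) $ i) + w $ i)"
      using set_borel_integral_eq_integral(1)[OF int[OF that]]
      by (intro continuous_intros indefinite_integral_continuous_1)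
    then show ?thesis by (rule continuous_on_eq) (simp add: x_eq that)
  qed
  show "((\<lambda>t. x t $ i) has_vector_derivative (A *\<^sub>v x t) $ i) (at t within {0..})"
    if t: "t \<ge> 0" and i: "i < n"
  proof -
    have "continuous_on {0..t + 1} (\<lambda>u. \<Sum>j<n. A $$ (i, j) * x u $ j)"
      by (intro continuous_intros cont_x) auto
    moreover have Ax: "(A *\<^sub>v x u) $ i = (\<Sum>j<n. A $$ (i, j) * x u $ j)" for u
      using A i xc[of u] by (simp add: scalar_prod_def atLeast0LessThan)
    ultimately have "((\<lambda>u. integral {0..u} (\<lambda>u. (A *\<^sub>v x u) $ i)) has_vector_derivative (A *\<^sub>v x t) $ i)
        (at t within {0..t + 1})"
      using t by (intro integral_has_vector_derivative) auto
    then have "((\<lambda>u. integral {0..u} (\<lambda>u. (A *\<^sub>v x u) $ i) + w $ i) has_vector_derivative (A *\<^sub>v x t) $ i)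
        (at t within {0..t + 1})"
      unfolding has_vector_derivative_add_const .
    then have "((\<lambda>t. x t $ i) has_vector_derivative (A *\<^sub>v x t) $ i) (at t within {0..t + 1})"
      by (rule has_vector_derivative_transform[rotated 2]) (use t in \<open>auto simp: x_eq i\<close>)
    moreover have "at t within {0..t + 1} = at t within {0..}"
      by (rule at_within_nhd[of t "{..<t + 1}"]) auto
    ultimately show ?thesis by simp
  qed
qed

lemma jordan_exp_0: "jordan_exp l k 0 = (if k = 0 then 1 else 0)"
  by (simp add: jordan_exp_def)

text \<open>Entrywise form of \<open>(exp (- t J))' = - J exp (- t J)\<close>: the shift in
  \<open>J\<close> leads to the next lower superdiagonal.\<close>

lemma jordan_exp_deriv:
  "(jordan_exp l k has_vector_derivative
     - l * jordan_exp l k t - (case k of 0 \<Rightarrow> 0 | Suc j \<Rightarrow> jordan_exp l j t)) (at t within S)"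
proof -
  have "((\<lambda>w. (- 1) ^ k / fact k * (w ^ k * exp (- (l * w)))) has_field_derivative
      - l * jordan_exp l k t - (case k of 0 \<Rightarrow> 0 | Suc j \<Rightarrow> jordan_exp l j t)) (at (complex_of_real t))"
  proof (cases k)
    case 0
    then show ?thesis by (auto intro!: derivative_eq_intros simp: jordan_exp_def)
  next
    case (Suc j)
    have "((\<lambda>w. w ^ Suc j * exp (- (l * w))) has_field_derivative
        (of_nat (Suc j) * complex_of_real t ^ j * exp (- (l * complex_of_real t))
          - l * (complex_of_real t ^ Suc j * exp (- (l * complex_of_real t))))) (at (complex_of_real t))"
      by (auto intro!: derivative_eq_intros simp del: power_Suc simp: algebra_simps) (cases j, auto)
    from DERIV_cmult[OF this, of "(- 1) ^ k / fact k"] show ?thesis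
      unfolding Suc by (rule DERIV_cong)
        (simp add: jordan_exp_def field_simps del: of_nat_Suc)
  qed
  from has_vector_derivative_real_field[OF this] show ?thesis
    unfolding jordan_exp_def .
qed

text \<open>Multiplication by the integrating factor \<open>exp (l t)\<close> gives a function with
  derivative 0.\<close>

lemma linear_ode_unique_zero:
  fixes u :: "real \<Rightarrow> complex"
  assumes deriv: "\<And>t. t \<ge> 0 \<Longrightarrow> (u has_vector_derivative - l * u t) (at t within {0..})"
    and "u 0 = 0" "t \<ge> 0"
  shows "u t = 0"
proof -
  have "((\<lambda>t. exp (l * complex_of_real t) * u t) has_vector_derivative 0) (at t within {0..})" if "t \<ge> 0" for t
  proof -
    have "((\<lambda>t. exp (l * complex_of_real t)) has_vector_derivative l * exp (l * complex_of_real t)) (at t within {0..})"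
      by (rule has_vector_derivative_real_field) (auto intro!: derivative_eq_intros)
    from has_vector_derivative_mult[OF this deriv[OF that]] show ?thesis by simp
  qed
  then obtain c where "\<And>t. t \<in> {0..} \<Longrightarrow> exp (l * complex_of_real t) * u t = c"
    by (rule has_vector_derivative_zero_constant[rotated]) auto
  from this[of t] this[of 0] have "exp (l * complex_of_real t) * u t = exp (l * complex_of_real 0) * u 0"
    using \<open>t \<ge> 0\<close> by simp
  then show ?thesis using \<open>u 0 = 0\<close> by simp
qed

text \<open>The candidate satisfies the p-th equation with the candidate for \<open>p + 1\<close> as
  source, and by induction this source is the true one. The difference thus solves the homogeneous
  equation with initial value 0.\<close>

lemma jordan_chain_solution:
  fixes z :: "nat \<Rightarrow> real \<Rightarrow> complex"
  assumes deriv: "\<And>p t. p < N \<Longrightarrow> t \<ge> 0 \<Longrightarrow>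
      (z p has_vector_derivative - (l * z p t + (if Suc p < N then z (Suc p) t else 0))) (at t within {0..})"
    and "p < N" "t \<ge> 0"
  shows "z p t = (\<Sum>q=p..<N. jordan_exp l (q - p) t * z q 0)"
  using assms(2,3)
proof (induction "N - p" arbitrary: p t)
  case (Suc d)
  let ?c = "\<lambda>p t. \<Sum>q=p..<N. jordan_exp l (q - p) t * z q 0"
  \<comment> \<open>This is the induction hypothesis if there is a next component; otherwise both
    sides are 0.\<close>
  have tail: "(if Suc p < N then z (Suc p) t else 0) = ?c (Suc p) t" if "t \<ge> 0" for t
    using Suc.hyps that by auto
  have split: "(\<Sum>q=p..<N. f q) = f p + (\<Sum>q=Suc p..<N. f q)" for f :: "nat \<Rightarrow> complex"
    using \<open>p < N\<close> by (rule sum.atLeast_Suc_lessThan)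
  have "(?c p has_vector_derivative (\<Sum>q=p..<N.
      (- l * jordan_exp l (q - p) t - (case q - p of 0 \<Rightarrow> 0 | Suc j \<Rightarrow> jordan_exp l j t)) * z q 0)) (at t within {0..})" for t
    by (intro has_vector_derivative_sum has_vector_derivative_mult_left jordan_exp_deriv)
  moreover have "(\<Sum>q=p..<N. (- l * jordan_exp l (q - p) t - (case q - p of 0 \<Rightarrow> 0 | Suc j \<Rightarrow> jordan_exp l j t)) * z q 0)
      = - (l * ?c p t + ?c (Suc p) t)" for t
  proof -
    have "(\<Sum>q=p..<N. (case q - p of 0 \<Rightarrow> 0 | Suc j \<Rightarrow> jordan_exp l j t) * z q 0) = ?c (Suc p) t"
    proof -
      have "q - p = Suc (q - Suc p)" if "Suc p \<le> q" for q using that by simp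
      then show ?thesis unfolding split by simp
    qed
    then show ?thesis
      by (simp add: left_diff_distrib sum_subtractf sum_negf sum_distrib_left mult.assoc)
  qed
  ultimately have c: "(?c p has_vector_derivative - (l * ?c p t + ?c (Suc p) t)) (at t within {0..})" for t
    by simp
  have "z p t - ?c p t = 0"
  proof (rule linear_ode_unique_zero[where l=l and u="\<lambda>t. z p t - ?c p t"])
    fix t :: real assume "t \<ge> 0"
    from has_vector_derivative_diff[OF deriv[OF \<open>p < N\<close> this] c[of t]]
    show "((\<lambda>t. z p t - ?c p t) has_vector_derivative - l * (z p t - ?c p t)) (at t within {0..})"
      unfolding tail[OF \<open>t \<ge> 0\<close>] by (simp add: algebra_simps)
  next
    \<comment> \<open>At time 0 only the term \<open>q = p\<close> survives.\<close>
    show "z p 0 - ?c p 0 = 0"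
      unfolding split by (auto simp: jordan_exp_0 intro!: sum.neutral)
  qed (fact Suc.prems(2))
  then show ?case by simp
qed simp

section \<open>Modal decomposition of the network\<close>

lemma similar_mat_wit_mult:
  fixes L :: "complex mat"
  assumes "similar_mat_wit L J R R_inv" and "L \<in> carrier_mat n n"
  shows "J \<in> carrier_mat n n" "R \<in> carrier_mat n n" "R_inv \<in> carrier_mat n n"
    and "R_inv * R = 1\<^sub>m n" "R * R_inv = 1\<^sub>m n" and "L * R = R * J" "R_inv * L = J * R_inv"
proof -
  show J: "J \<in> carrier_mat n n" and R: "R \<in> carrier_mat n n" and Ri: "R_inv \<in> carrier_mat n n"
    and inv: "R_inv * R = 1\<^sub>m n" "R * R_inv = 1\<^sub>m n"
    using assms by (auto simp: similar_mat_wit_def Let_def)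
  have L: "L = R * J * R_inv" using assms by (auto simp: similar_mat_wit_def Let_def)
  have "L * R = R * J * (R_inv * R)" unfolding L using J R Ri by (intro assoc_mult_mat) auto
  then show "L * R = R * J" using inv J R by simp
  have "R_inv * L = R_inv * R * (J * R_inv)"
    unfolding L using J R Ri by (simp add: assoc_mult_mat[of _ n n _ n _ n])
  then show "R_inv * L = J * R_inv" using inv J Ri by simp
qed

text \<open>An eigenvector at the head of a further Jordan chain with eigenvalue in the closed left
  half-plane would be constant, hence parallel to the first column of \<open>R\<close>.\<close>

lemma laplacian_jordan_eigenvalue_pos:
  assumes G: "weighted_digraph n b" and r: "globally_reachable n b r"
    and sim: "similar_mat_wit (complex_mat (laplacian n b)) (jordan_matrix bs) R R_inv"
    and sizes: "\<forall>k<length bs. block_size bs k \<ge> 1"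
    and col0: "col R 0 = vec n (\<lambda>_. \<alpha>)"
    and k: "1 \<le> k" "k < length bs"
  shows "Re (block_eigenvalue bs k) > 0"
proof (rule ccontr)
  assume neg: "\<not> Re (block_eigenvalue bs k) > 0"
  let ?L = "complex_mat (laplacian n b)" and ?l = "block_eigenvalue bs k"
  define d where "d = block_offset (map fst bs) k"
  have Lc: "?L \<in> carrier_mat n n" by (simp add: laplacian_def)
  note S = similar_mat_wit_mult[OF sim Lc]
  have n: "sum_list (map fst bs) = n" using S(1) by (metis carrier_matD(1) jordan_matrix_dim(1))
  have d: "d < n"
    using block_offset_add_less[of k "map fst bs" 0] k sizes by (force simp: block_size_def d_def n)
  have "block_offset (map fst bs) 1 \<le> d" unfolding d_def using k by (intro block_offset_mono) simp
  moreover have "block_offset (map fst bs) (Suc 0) \<ge> 1"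
  proof -
    have "0 < length bs" using k by linarith
    then show ?thesis using sizes by (simp add: block_offset_Suc block_size_def)
  qed
  \<comment> \<open>Column d differs from the constant column 0 because the first block is
    nonempty.\<close>
  ultimately have d0: "d \<noteq> 0" by simp
  have "laplacian_eigenfunction n b ?l (\<lambda>i. R $$ (i, d))"
    unfolding laplacian_eigenfunction_def
  proof (intro allI impI)
    fix i assume i: "i < n"
    have "(\<Sum>j<n. complex_of_real (b i j) * (R $$ (i, d) - R $$ (j, d))) = (?L *\<^sub>v col R d) $ i"
      using S(2) d by (subst laplacian_mult_vec[OF i G]) (auto intro!: sum.cong simp: i)
    also have "\<dots> = (?L * R) $$ (i, d)" using i d Lc S(2) by simp
    also have "\<dots> = (\<Sum>m<n. R $$ (i, m) * jordan_matrix bs $$ (m, d))"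
      unfolding S(6) using i d S(2) by (auto simp: scalar_prod_def atLeast0LessThan n intro!: sum.cong)
    also have "\<dots> = (\<Sum>m<n. if m = d then R $$ (i, d) * ?l else 0)"
      using jordan_matrix_first_column[OF k(2)] sizes k d
      by (intro sum.cong refl) (force simp: d_def n)
    also have "\<dots> = ?l * R $$ (i, d)" using d by simp
    finally show "?l * R $$ (i, d) = (\<Sum>j<n. complex_of_real (b i j) * (R $$ (i, d) - R $$ (j, d)))" ..
  qed
  from laplacian_eigenfunction_const[OF G r this] neg
  have const: "R $$ (i, d) = R $$ (r, d)" if "i < n" for i using that by simp
  have col0': "R $$ (i, 0) = \<alpha>" if "i < n" for i
  proof -
    have "R $$ (i, 0) = col R 0 $ i" using that S(2) by simp
    then show ?thesis using that by (simp add: col0)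
  qed
  have id: "(\<Sum>m<n. R_inv $$ (i, m) * R $$ (m, j)) = (if i = j then 1 else 0)" if "i < n" "j < n" for i j
  proof -
    have "(\<Sum>m<n. R_inv $$ (i, m) * R $$ (m, j)) = (R_inv * R) $$ (i, j)"
      using that S(2,3) by (simp add: scalar_prod_def atLeast0LessThan)
    then show ?thesis using that by (simp add: S(4))
  qed
  \<comment> \<open>\<open>s\<close> is \<open>R_inv\<close> applied to the all-ones vector. If
    columns 0 and d of \<open>R\<close> are both multiples of that vector, the entries of
    \<open>R_inv R = I\<close> contradict each other: \<open>s 0\<close> is nonzero, which forces
    column d to vanish.\<close>
  define s where "s i = (\<Sum>m<n. R_inv $$ (i, m))" for i
  have "s i * \<alpha> = (if i = 0 then 1 else 0)" if "i < n" for i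
    using id[OF that, of 0] d by (simp add: s_def sum_distrib_right col0')
  moreover have "s i * R $$ (r, d) = (if i = d then 1 else 0)" if "i < n" for i
  proof -
    have "s i * R $$ (r, d) = (\<Sum>m<n. R_inv $$ (i, m) * R $$ (m, d))"
      unfolding s_def sum_distrib_right by (intro sum.cong refl) (simp add: const)
    then show ?thesis using id[OF that d] by simp
  qed
  ultimately have "s 0 * \<alpha> = 1" "s 0 * R $$ (r, d) = 0" "s d * R $$ (r, d) = 1"
    using d d0 by fastforce+
  then show False by auto
qed

lemma mult_mat_vec_sum:
  "A \<in> carrier_mat m n \<Longrightarrow> v \<in> carrier_vec n \<Longrightarrow> i < m \<Longrightarrow>
    (A *\<^sub>v v) $ i = (\<Sum>j<n. A $$ (i, j) * v $ j)"
  by (auto simp: scalar_prod_def atLeast0LessThan intro!: sum.cong)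

lemma cscalar_prod_sum:
  "u \<in> carrier_vec n \<Longrightarrow> v \<bullet>c u = (\<Sum>i<n. v $ i * cnj (u $ i))"
  by (auto simp: scalar_prod_def atLeast0LessThan intro!: sum.cong)

lemma complex_mat_mult_vec:
  "A \<in> carrier_mat m n \<Longrightarrow> v \<in> carrier_vec n \<Longrightarrow>
    complex_vec (A *\<^sub>v v) = complex_mat A *\<^sub>v complex_vec v"
  by (intro eq_vecI) (auto simp: scalar_prod_def)

lemma modal_solution:
  assumes A: "A \<in> carrier_mat n n"
    and sim: "similar_mat_wit (complex_mat A) (jordan_matrix bs) R R_inv"
    and w: "w \<in> carrier_vec n" and x: "impulse_response (- A) w x"
    and k: "k < length bs" and p: "p < block_size bs k" and t: "t \<ge> 0"
  shows "(R_inv *\<^sub>v complex_vec (x t)) $ (block_offset (map fst bs) k + p)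
    = (\<Sum>q=p..<block_size bs k. jordan_exp (block_eigenvalue bs k) (q - p) t
        * (R_inv *\<^sub>v complex_vec w) $ (block_offset (map fst bs) k + q))"
proof -
  let ?d = "block_offset (map fst bs) k"
  have Ac: "complex_mat A \<in> carrier_mat n n" using A by simp
  note S = similar_mat_wit_mult[OF sim Ac]
  have n: "sum_list (map fst bs) = n" using S(1) by (metis carrier_matD(1) jordan_matrix_dim(1))
  have mA: "- A \<in> carrier_mat n n" using A by simp
  note ivp = impulse_response_initial_value_problem[OF mA w x]
  have xc: "x t \<in> carrier_vec n" for t using x w by (simp add: impulse_response_def)
  define z where "z i t = (R_inv *\<^sub>v complex_vec (x t)) $ i" for i t
  have z_deriv: "(z i has_vector_derivative - (jordan_matrix bs *\<^sub>v (R_inv *\<^sub>v complex_vec (x t))) $ i)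
      (at t within {0..})" if i: "i < n" and t: "t \<ge> 0" for i t
  proof -
    have z: "z i = (\<lambda>t. \<Sum>j<n. R_inv $$ (i, j) * complex_of_real (x t $ j))"
      unfolding z_def
      using S(3) xc i by (intro ext) (simp add: scalar_prod_def atLeast0LessThan carrier_vecD[OF xc])
    have "(z i has_vector_derivative (\<Sum>j<n. R_inv $$ (i, j) * complex_of_real ((- A *\<^sub>v x t) $ j)))
        (at t within {0..})"
      unfolding z
      by (intro has_vector_derivative_sum has_vector_derivative_mult_right has_vector_derivative_of_real)
         (auto simp: has_real_derivative_iff_has_vector_derivative intro!: ivp(2) t)
    also have "(\<Sum>j<n. R_inv $$ (i, j) * complex_of_real ((- A *\<^sub>v x t) $ j))
        = (\<Sum>j<n. R_inv $$ (i, j) * - ((complex_mat A *\<^sub>v complex_vec (x t)) $ j))"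
    proof (intro sum.cong refl)
      fix j assume "j \<in> {..<n}"
      then have "(- A *\<^sub>v x t) $ j = - ((A *\<^sub>v x t) $ j)"
        using A xc[of t] by (simp add: scalar_prod_def sum_negf)
      moreover have "complex_of_real ((A *\<^sub>v x t) $ j) = (complex_mat A *\<^sub>v complex_vec (x t)) $ j"
        using \<open>j \<in> {..<n}\<close> A by (simp flip: complex_mat_mult_vec[OF A xc])
      ultimately show "R_inv $$ (i, j) * complex_of_real ((- A *\<^sub>v x t) $ j)
          = R_inv $$ (i, j) * - ((complex_mat A *\<^sub>v complex_vec (x t)) $ j)" by simp
    qed
    also have "\<dots> = - (R_inv *\<^sub>v (complex_mat A *\<^sub>v complex_vec (x t))) $ i"
      using S(3) A i by (simp add: scalar_prod_def atLeast0LessThan sum_negf)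
    also have "R_inv *\<^sub>v (complex_mat A *\<^sub>v complex_vec (x t)) = R_inv * complex_mat A *\<^sub>v complex_vec (x t)"
      using S(3) Ac xc[of t] by (intro assoc_mult_mat_vec[symmetric]) auto
    also have "\<dots> = jordan_matrix bs *\<^sub>v (R_inv *\<^sub>v complex_vec (x t))"
      unfolding S(7) using S(1,3) xc[of t] by (intro assoc_mult_mat_vec) auto
    finally show ?thesis .
  qed
  have less: "?d + q < n" if "q < block_size bs k" for q
    using block_offset_add_less[of k "map fst bs" q] that k by (simp add: block_size_def n)
  have "z (?d + p) t = (\<Sum>q=p..<block_size bs k. jordan_exp (block_eigenvalue bs k) (q - p) t * z (?d + q) 0)"
  proof (rule jordan_chain_solution[OF _ p t])
    fix q and t :: real assume q: "q < block_size bs k" and "t \<ge> 0"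
    have v: "R_inv *\<^sub>v complex_vec (x t) \<in> carrier_vec (sum_list (map fst bs))"
      unfolding n using S(3) xc[of t] by auto
    show "(z (?d + q) has_vector_derivative - (block_eigenvalue bs k * z (?d + q) t
        + (if Suc q < block_size bs k then z (?d + Suc q) t else 0))) (at t within {0..})"
      using z_deriv[OF less[OF q] \<open>t \<ge> 0\<close>] unfolding jordan_matrix_mult_vec[OF k q v]
      by (simp add: z_def cong: if_cong)
  qed
  then show ?thesis by (simp add: z_def ivp(1))
qed

section \<open>Output energy\<close>

text \<open>Orthonormality says that the conjugate transpose of the basis matrix is a left inverse;
  for square matrices it is then also a right inverse, and that is the expansion.\<close>

lemma orthonormal_completeness:
  fixes \<theta> :: "nat \<Rightarrow> complex vec"
  assumes c: "\<forall>i<n. \<theta> i \<in> carrier_vec n"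
    and o: "\<forall>i<n. \<forall>j<n. \<theta> i \<bullet>c \<theta> j = (if i = j then 1 else 0)"
    and v: "v \<in> carrier_vec n" and i: "i < n"
  shows "v $ i = (\<Sum>l<n. (v \<bullet>c \<theta> l) * \<theta> l $ i)"
proof -
  define T where "T = mat n n (\<lambda>(i, l). \<theta> l $ i)"
  define U where "U = mat n n (\<lambda>(l, i). cnj (\<theta> l $ i))"
  have T: "T \<in> carrier_mat n n" and U: "U \<in> carrier_mat n n" by (auto simp: T_def U_def)
  have "U * T = 1\<^sub>m n"
  proof (rule eq_matI)
    fix l m assume lm: "l < dim_row (1\<^sub>m n :: complex mat)" "m < dim_col (1\<^sub>m n :: complex mat)"
    then have "(U * T) $$ (l, m) = \<theta> m \<bullet>c \<theta> l"
      using carrier_vecD[of "\<theta> l" n] carrier_vecD[of "\<theta> m" n] c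
      by (auto simp: U_def T_def scalar_prod_def intro!: sum.cong)
    then show "(U * T) $$ (l, m) = 1\<^sub>m n $$ (l, m)" using o lm by auto
  qed (auto simp: T_def U_def)
  then have TU: "T * U = 1\<^sub>m n" by (rule mat_mult_left_right_inverse[OF U T])
  have "(\<Sum>l<n. (v \<bullet>c \<theta> l) * \<theta> l $ i) = (\<Sum>l<n. \<Sum>j<n. v $ j * (T $$ (i, l) * U $$ (l, j)))"
  proof (intro sum.cong refl)
    fix l assume "l \<in> {..<n}"
    then have "\<theta> l \<in> carrier_vec n" using c by auto
    from cscalar_prod_sum[OF this, of v] show "(v \<bullet>c \<theta> l) * \<theta> l $ i = (\<Sum>j<n. v $ j * (T $$ (i, l) * U $$ (l, j)))"
      using i \<open>l \<in> {..<n}\<close> by (simp add: T_def U_def sum_distrib_left sum_distrib_right mult_ac)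
  qed
  also have "\<dots> = (\<Sum>j<n. v $ j * (\<Sum>l<n. T $$ (i, l) * U $$ (l, j)))"
    by (subst sum.swap) (simp add: sum_distrib_left)
  also have "\<dots> = (\<Sum>j<n. v $ j * (T * U) $$ (i, j))"
    using i T U by (intro sum.cong refl) (auto simp: scalar_prod_def atLeast0LessThan)
  also have "\<dots> = (\<Sum>j<n. if j = i then v $ i else 0)"
    unfolding TU using i by (intro sum.cong refl) auto
  also have "\<dots> = v $ i" using i by simp
  finally show ?thesis ..
qed

lemma mat_adjoint_entry:
  fixes A :: "complex mat"
  assumes "A \<in> carrier_mat m n" "i < n" "j < m"
  shows "mat_adjoint A $$ (i, j) = cnj (A $$ (j, i))"
  using assms by (simp add: mat_adjoint_def mat_of_rows_def)

lemma mat_adjoint_carrier: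
  "A \<in> carrier_mat m n \<Longrightarrow> mat_adjoint A \<in> carrier_mat n m"
  by (auto simp: mat_adjoint_def)

lemma inner_mult_mat_vec:
  fixes A :: "complex mat"
  assumes A: "A \<in> carrier_mat m n" and u: "u \<in> carrier_vec n" and v: "v \<in> carrier_vec n"
  shows "(A *\<^sub>v v) \<bullet>c (A *\<^sub>v u) = ((mat_adjoint A * A) *\<^sub>v v) \<bullet>c u"
proof -
  have "((mat_adjoint A * A) *\<^sub>v v) \<bullet>c u = (mat_adjoint A *\<^sub>v (A *\<^sub>v v)) \<bullet>c u"
    using A v mat_adjoint_carrier[OF A] by (subst assoc_mult_mat_vec) auto
  also have "\<dots> = (\<Sum>i<n. \<Sum>r<m. cnj (A $$ (r, i)) * (A *\<^sub>v v) $ r * cnj (u $ i))"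
    unfolding cscalar_prod_sum[OF u] sum_distrib_right[symmetric]
    using A v by (intro sum.cong refl arg_cong2[where f="(*)"])
      (auto simp: mult_mat_vec_sum[OF mat_adjoint_carrier[OF A]] mat_adjoint_entry[OF A] simp del: index_mult_mat_vec)
  also have "\<dots> = (\<Sum>r<m. (A *\<^sub>v v) $ r * cnj (\<Sum>i<n. A $$ (r, i) * u $ i))"
    by (subst sum.swap) (simp add: sum_distrib_left mult_ac)
  also have "\<dots> = (A *\<^sub>v v) \<bullet>c (A *\<^sub>v u)"
    using A u by (subst cscalar_prod_sum[where n=m])
      (auto simp: mult_mat_vec_sum[OF A u] simp del: index_mult_mat_vec intro!: sum.cong)
  finally show ?thesis ..
qed

text \<open>\<open>\<nu>\<close> is the spectral expansion of the Hermitian form of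
  \<open>C^* C\<close> on the columns of \<open>R\<close>. Resummed, it is a Gram matrix in which
  the eigenbasis no longer appears.\<close>

lemma \<nu>_eq_inner:
  assumes C: "C \<in> carrier_mat m n" and R: "R \<in> carrier_mat n n"
    and c: "\<forall>i<n. \<theta> i \<in> carrier_vec n"
    and o: "\<forall>i<n. \<forall>j<n. \<theta> i \<bullet>c \<theta> j = (if i = j then 1 else 0)"
    and eig: "\<forall>i<n. eigenvector (mat_adjoint C * C) (\<theta> i) (\<mu> i)"
    and \<mu>0: "\<mu> 0 = 0" and ij: "i < n" "j < n"
  shows "\<nu> n R \<theta> \<mu> i j = (C *\<^sub>v col R j) \<bullet>c (C *\<^sub>v col R i)"
proof -
  let ?M = "mat_adjoint C * C" and ?v = "col R j" and ?u = "col R i"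
  have u: "?u \<in> carrier_vec n" and v: "?v \<in> carrier_vec n" using R ij by auto
  have M: "?M \<in> carrier_mat n n" using C mat_adjoint_carrier[OF C] by auto
  have M\<theta>: "(\<Sum>q<n. ?M $$ (p, q) * \<theta> l $ q) = \<mu> l * \<theta> l $ p" if "p < n" "l < n" for p l
  proof -
    have cl: "\<theta> l \<in> carrier_vec n" using c that by simp
    have "(?M *\<^sub>v \<theta> l) $ p = \<mu> l * \<theta> l $ p" using eig that cl by (simp add: eigenvector_def)
    then show ?thesis using mult_mat_vec_sum[OF M cl that(1)] by simp
  qed
  have Mv: "(?M *\<^sub>v ?v) $ p = (\<Sum>l<n. (?v \<bullet>c \<theta> l) * \<mu> l * \<theta> l $ p)" if p: "p < n" for p
  proof -
    have "(?M *\<^sub>v ?v) $ p = (\<Sum>q<n. ?M $$ (p, q) * ?v $ q)"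
      by (rule mult_mat_vec_sum[OF M v p])
    also have "\<dots> = (\<Sum>q<n. \<Sum>l<n. (?v \<bullet>c \<theta> l) * (?M $$ (p, q) * \<theta> l $ q))"
    proof (intro sum.cong refl)
      fix q assume "q \<in> {..<n}"
      then have "?v $ q = (\<Sum>l<n. (?v \<bullet>c \<theta> l) * \<theta> l $ q)"
        by (intro orthonormal_completeness[OF c o v]) simp
      then show "?M $$ (p, q) * ?v $ q = (\<Sum>l<n. (?v \<bullet>c \<theta> l) * (?M $$ (p, q) * \<theta> l $ q))"
        by (simp only: sum_distrib_left mult.left_commute)
    qed
    also have "\<dots> = (\<Sum>l<n. (?v \<bullet>c \<theta> l) * (\<Sum>q<n. ?M $$ (p, q) * \<theta> l $ q))"
      by (subst sum.swap) (simp only: sum_distrib_left)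
    also have "\<dots> = (\<Sum>l<n. (?v \<bullet>c \<theta> l) * \<mu> l * \<theta> l $ p)"
      by (intro sum.cong refl) (simp only: M\<theta>[OF p] lessThan_iff mult.assoc)
    finally show ?thesis .
  qed
  have "(C *\<^sub>v ?v) \<bullet>c (C *\<^sub>v ?u) = (\<Sum>p<n. (?M *\<^sub>v ?v) $ p * cnj (?u $ p))"
    unfolding inner_mult_mat_vec[OF C u v] by (rule cscalar_prod_sum[OF u])
  also have "\<dots> = (\<Sum>p<n. \<Sum>l<n. (?v \<bullet>c \<theta> l) * \<mu> l * (\<theta> l $ p * cnj (?u $ p)))"
    by (intro sum.cong refl) (simp only: Mv lessThan_iff sum_distrib_right mult.assoc)
  also have "\<dots> = (\<Sum>l<n. (?v \<bullet>c \<theta> l) * \<mu> l * (\<Sum>p<n. \<theta> l $ p * cnj (?u $ p)))"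
    by (subst sum.swap) (simp only: sum_distrib_left)
  also have "\<dots> = (\<Sum>l<n. (\<theta> l \<bullet>c ?u) * (?v \<bullet>c \<theta> l) * \<mu> l)"
    by (intro sum.cong refl) (simp only: cscalar_prod_sum[OF u] mult_ac)
  also have "\<dots> = (\<Sum>l\<in>{1..<n}. (\<theta> l \<bullet>c ?u) * (?v \<bullet>c \<theta> l) * \<mu> l)"
    using \<mu>0 by (intro sum.mono_neutral_right) (auto simp: not_less_eq_eq Suc_le_eq)
  finally show ?thesis by (simp add: \<nu>_def)
qed

lemma mult_mat_sum:
  "A \<in> carrier_mat m n \<Longrightarrow> B \<in> carrier_mat n p \<Longrightarrow> i < m \<Longrightarrow> j < p \<Longrightarrow>
    (A * B) $$ (i, j) = (\<Sum>k<n. A $$ (i, k) * B $$ (k, j))"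
  by (auto simp: scalar_prod_def atLeast0LessThan intro!: sum.cong)

text \<open>The matrix \<open>C R\<close>, called \<open>K\<close> below, maps modal coordinates to
  the output, so the energy is the quadratic form of the Gram matrix of its columns, whose entries
  are \<open>\<nu>\<close>. Column 0 is zero, which removes the one mode that does not
  decay.\<close>

lemma output_energy_modal:
  fixes C :: "real mat" and x :: "real vec"
  assumes C: "C \<in> carrier_mat q0 n" and C1: "C *\<^sub>v vec n (\<lambda>_. 1) = 0\<^sub>v q0"
    and R: "R \<in> carrier_mat n n" and Ri: "R_inv \<in> carrier_mat n n" and inv: "R * R_inv = 1\<^sub>m n"
    and col0: "col R 0 = vec n (\<lambda>_. \<alpha>)" and x: "x \<in> carrier_vec n"
    and c: "\<forall>i<n. \<theta> i \<in> carrier_vec n"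
    and o: "\<forall>i<n. \<forall>j<n. \<theta> i \<bullet>c \<theta> j = (if i = j then 1 else 0)"
    and eig: "\<forall>i<n. eigenvector (mat_adjoint (complex_mat C) * complex_mat C) (\<theta> i) (\<mu> i)"
    and \<mu>0: "\<mu> 0 = 0"
  defines "z \<equiv> R_inv *\<^sub>v complex_vec x"
  shows "complex_of_real ((C *\<^sub>v x) \<bullet>c (C *\<^sub>v x))
    = (\<Sum>i\<in>{1..<n}. cnj (z $ i) * (\<Sum>j\<in>{1..<n}. z $ j * \<nu> n R \<theta> \<mu> i j))"
proof -
  let ?C = "complex_mat C"
  define K where "K r j = (?C *\<^sub>v col R j) $ r" for r j
  have Cc: "?C \<in> carrier_mat q0 n" using C by simp
  have z: "z \<in> carrier_vec n" unfolding z_def using Ri x by auto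
  have xz: "complex_vec x = R *\<^sub>v z"
    unfolding z_def using R Ri x by (subst assoc_mult_mat_vec[symmetric]) (auto simp: inv)
  have cols: "col R j \<in> carrier_vec n" for j using R by auto
  have K: "K r j = (\<Sum>m<n. ?C $$ (r, m) * R $$ (m, j))" if "r < q0" "j < n" for r j
    unfolding K_def mult_mat_vec_sum[OF Cc cols that(1)] using R that by (intro sum.cong) auto
  have K0: "K r 0 = 0" if r: "r < q0" for r
  proof -
    have "(\<Sum>m<n. C $$ (r, m)) = (C *\<^sub>v vec n (\<lambda>_. 1)) $ r"
      by (subst mult_mat_vec_sum[OF C _ r]) (auto intro!: sum.cong)
    then have C0: "(\<Sum>m<n. C $$ (r, m)) = 0" using r by (simp add: C1)
    have "K r 0 = (\<Sum>m<n. complex_of_real (C $$ (r, m)) * \<alpha>)"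
      unfolding K_def col0 using C r by (subst mult_mat_vec_sum[OF Cc _ r]) (auto intro!: sum.cong)
    also have "\<dots> = complex_of_real (\<Sum>m<n. C $$ (r, m)) * \<alpha>" by (simp add: sum_distrib_right)
    finally show ?thesis using C0 by simp
  qed
  have Y: "complex_of_real ((C *\<^sub>v x) $ r) = (\<Sum>j\<in>{1..<n}. K r j * z $ j)" if r: "r < q0" for r
  proof -
    have "complex_of_real ((C *\<^sub>v x) $ r) = (?C *\<^sub>v (R *\<^sub>v z)) $ r"
      unfolding xz[symmetric] complex_mat_mult_vec[OF C x, symmetric] using C r by simp
    also have "\<dots> = (\<Sum>m<n. ?C $$ (r, m) * (R *\<^sub>v z) $ m)"
      using R z by (intro mult_mat_vec_sum[OF Cc _ r]) auto
    also have "\<dots> = (\<Sum>m<n. \<Sum>j<n. ?C $$ (r, m) * R $$ (m, j) * z $ j)"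
      by (intro sum.cong refl) (simp only: mult_mat_vec_sum[OF R z] lessThan_iff sum_distrib_left mult.assoc)
    also have "\<dots> = (\<Sum>j<n. K r j * z $ j)"
      by (subst sum.swap) (auto simp only: K[OF r] sum_distrib_right lessThan_iff intro!: sum.cong)
    also have "\<dots> = (\<Sum>j\<in>{1..<n}. K r j * z $ j)"
      using K0[OF r] by (intro sum.mono_neutral_right) (auto simp: not_less_eq_eq Suc_le_eq)
    finally show ?thesis .
  qed
  have \<nu>: "\<nu> n R \<theta> \<mu> i j = (\<Sum>r<q0. K r j * cnj (K r i))" if "i < n" "j < n" for i j
    unfolding \<nu>_eq_inner[OF Cc R c o eig \<mu>0 that] K_def
    by (rule cscalar_prod_sum) (use Cc in \<open>auto intro: mult_mat_vec_carrier[OF _ cols]\<close>)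
  have "C *\<^sub>v x \<in> carrier_vec q0" using C x by auto
  \<comment> \<open>The output is real, so one factor may be conjugated; expanding that factor
    yields the conjugated modes.\<close>
  then have "complex_of_real ((C *\<^sub>v x) \<bullet>c (C *\<^sub>v x))
      = (\<Sum>r<q0. cnj (complex_of_real ((C *\<^sub>v x) $ r)) * complex_of_real ((C *\<^sub>v x) $ r))"
    using C by (auto simp: scalar_prod_def atLeast0LessThan simp del: index_mult_mat_vec intro!: sum.cong)
  also have "\<dots> = (\<Sum>r<q0. \<Sum>i\<in>{1..<n}. \<Sum>j\<in>{1..<n}. cnj (z $ i) * (z $ j * (K r j * cnj (K r i))))"
  proof (rule sum.cong[OF refl])
    fix r assume "r \<in> {..<q0}"
    then have "r < q0" by simp
    show "cnj (complex_of_real ((C *\<^sub>v x) $ r)) * complex_of_real ((C *\<^sub>v x) $ r)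
        = (\<Sum>i\<in>{1..<n}. \<Sum>j\<in>{1..<n}. cnj (z $ i) * (z $ j * (K r j * cnj (K r i))))"
      unfolding Y[OF \<open>r < q0\<close>] cnj_sum sum_product by (intro sum.cong refl) simp
  qed
  also have "\<dots> = (\<Sum>i\<in>{1..<n}. \<Sum>r<q0. \<Sum>j\<in>{1..<n}. cnj (z $ i) * (z $ j * (K r j * cnj (K r i))))"
    by (rule sum.swap)
  also have "\<dots> = (\<Sum>i\<in>{1..<n}. \<Sum>j\<in>{1..<n}. \<Sum>r<q0. cnj (z $ i) * (z $ j * (K r j * cnj (K r i))))"
    by (intro sum.cong refl sum.swap)
  also have "\<dots> = (\<Sum>i\<in>{1..<n}. cnj (z $ i) * (\<Sum>j\<in>{1..<n}. z $ j * \<nu> n R \<theta> \<mu> i j))"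
    unfolding sum_distrib_left by (intro sum.cong refl) (simp add: \<nu> sum_distrib_left)
  finally show ?thesis .
qed

text \<open>The matrix has rank at most one: it is the outer product of the initial modal
  coordinates with themselves. The shift by \<open>Suc\<close> comes from the row removed in
  \<open>Q_tilde\<close>.\<close>

lemma \<Sigma>_Q_entry:
  assumes Ri: "R_inv \<in> carrier_mat n n" and w: "w \<in> carrier_vec n" and ij: "Suc i < n" "Suc j < n"
  shows "\<Sigma>_Q n R_inv w $$ (i, j)
    = (R_inv *\<^sub>v complex_vec w) $ Suc i * cnj ((R_inv *\<^sub>v complex_vec w) $ Suc j)"
proof -
  define Q where "Q = Q_tilde n R_inv"
  define W where "W = mat_of_cols n [complex_vec w]"
  have Q: "Q \<in> carrier_mat (n - 1) n" by (simp add: Q_def Q_tilde_def)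
  have W: "W \<in> carrier_mat n 1" unfolding W_def carrier_mat_def by simp
  note aQ = mat_adjoint_carrier[OF Q] and aW = mat_adjoint_carrier[OF W]
  have WW: "W * mat_adjoint W \<in> carrier_mat n n" using W aW by auto
  have QWW: "Q * (W * mat_adjoint W) \<in> carrier_mat (n - 1) n" using Q WW by auto
  have Wr: "W $$ (r, 0) = complex_of_real (w $ r)" if "r < n" for r
    using that w by (simp add: W_def mat_of_cols_def)
  have WWe: "(W * mat_adjoint W) $$ (r, m) = complex_of_real (w $ r) * cnj (complex_of_real (w $ m))"
    if "r < n" "m < n" for r m
    using that by (simp add: mult_mat_sum[OF W aW] mat_adjoint_entry[OF W] Wr)
  have i: "i < n - 1" and j: "j < n - 1" using ij by auto
  have cw: "complex_vec w \<in> carrier_vec n" using w by simp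
  have Qw: "(R_inv *\<^sub>v complex_vec w) $ Suc i' = (\<Sum>r<n. Q $$ (i', r) * complex_of_real (w $ r))"
    if "Suc i' < n" for i'
    unfolding mult_mat_vec_sum[OF Ri cw that] using that w by (intro sum.cong) (auto simp: Q_def Q_tilde_def)
  have "\<Sigma>_Q n R_inv w $$ (i, j) = (\<Sum>m<n. (Q * (W * mat_adjoint W)) $$ (i, m) * cnj (Q $$ (j, m)))"
    unfolding \<Sigma>_Q_def Let_def Q_def[symmetric] W_def[symmetric] mult_mat_sum[OF QWW aQ i j]
    by (intro sum.cong refl) (simp add: mat_adjoint_entry[OF Q _ j])
  also have "\<dots> = (\<Sum>m<n. (\<Sum>r<n. Q $$ (i, r) * complex_of_real (w $ r)) * cnj (Q $$ (j, m) * complex_of_real (w $ m)))"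
    by (intro sum.cong refl) (simp add: mult_mat_sum[OF Q WW i] WWe sum_distrib_left sum_distrib_right mult_ac)
  also have "\<dots> = (R_inv *\<^sub>v complex_vec w) $ Suc i * cnj ((R_inv *\<^sub>v complex_vec w) $ Suc j)"
    by (simp add: Qw[OF ij(1)] Qw[OF ij(2)] sum_distrib_left)
  finally show ?thesis .
qed

lemma sum_blocks_tail:
  assumes "ns \<noteq> []" "ns ! 0 = 1" "sum_list ns = n"
  shows "(\<Sum>i\<in>{1..<n}. f i) = (\<Sum>k<length ns - 1. \<Sum>p<ns ! Suc k. f (block_offset ns (Suc k) + p))"
proof -
  obtain ms where ns: "ns = 1 # ms" using assms(1,2) by (cases ns) auto
  have "(\<Sum>i\<in>{1..<n}. f i) = (\<Sum>i<sum_list ms. f (Suc i))"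
    using assms(3) sum.shift_bounds_Suc_ivl[of f 0 "sum_list ms"] by (simp add: ns lessThan_atLeast0)
  then show ?thesis by (simp add: ns sum_blocks)
qed

text \<open>The energy comes sorted by the observed modes p and a, with \<open>q \<ge> p\<close> and
  \<open>b \<ge> a\<close> inside; the entries of \<open>\<Psi>\<close> are indexed by q and b, with
  p and a summed inside.\<close>

lemma sum_block_rearrange:
  fixes F :: "nat \<Rightarrow> nat \<Rightarrow> nat \<Rightarrow> nat \<Rightarrow> nat \<Rightarrow> nat \<Rightarrow> 'a::comm_monoid_add"
  shows "(\<Sum>k<m. \<Sum>p<s k. \<Sum>q=p..<s k. \<Sum>l<m. \<Sum>a<s l. \<Sum>b=a..<s l. F k p q l a b)
    = (\<Sum>k<m. \<Sum>q<s k. \<Sum>l<m. \<Sum>b<s l. \<Sum>p\<le>q. \<Sum>a\<le>b. F k p q l a b)"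
proof (rule sum.cong[OF refl])
  fix k
  have "(\<Sum>p<s k. \<Sum>q=p..<s k. \<Sum>l<m. \<Sum>a<s l. \<Sum>b=a..<s l. F k p q l a b)
      = (\<Sum>q<s k. \<Sum>p\<le>q. \<Sum>l<m. \<Sum>b<s l. \<Sum>a\<le>b. F k p q l a b)"
    by (simp only: sum_triangle_swap)
  also have "\<dots> = (\<Sum>q<s k. \<Sum>l<m. \<Sum>p\<le>q. \<Sum>b<s l. \<Sum>a\<le>b. F k p q l a b)"
    by (intro sum.cong refl sum.swap)
  also have "\<dots> = (\<Sum>q<s k. \<Sum>l<m. \<Sum>b<s l. \<Sum>p\<le>q. \<Sum>a\<le>b. F k p q l a b)"
    by (intro sum.cong refl sum.swap)
  finally show "(\<Sum>p<s k. \<Sum>q=p..<s k. \<Sum>l<m. \<Sum>a<s l. \<Sum>b=a..<s l. F k p q l a b)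
      = (\<Sum>q<s k. \<Sum>l<m. \<Sum>b<s l. \<Sum>p\<le>q. \<Sum>a\<le>b. F k p q l a b)" .
qed

theorem theorem1:
  fixes n q0 :: nat
    and B :: "nat \<Rightarrow> nat \<Rightarrow> real"
    and C :: "real mat"
    and R R_inv :: "complex mat"
    and bs :: "(nat \<times> complex) list"
    and \<theta> :: "nat \<Rightarrow> complex vec"
    and \<mu> :: "nat \<Rightarrow> complex"
    and w0 :: "real vec"
    and x y :: "real \<Rightarrow> real vec"
  assumes "n \<ge> 2"
    and "weighted_digraph n B"
    and "\<exists>r. globally_reachable n B r"
    and "C \<in> carrier_mat q0 n"
    and "C *\<^sub>v vec n (\<lambda>_. 1) = 0\<^sub>v q0"
    and "similar_mat_wit (complex_mat (laplacian n B)) (jordan_matrix bs) R R_inv"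
    and "\<forall>k<length bs. block_size bs k \<ge> 1"
    and "bs \<noteq> []" and "bs ! 0 = (1, 0)"
    and "\<exists>\<alpha>. col R 0 = vec n (\<lambda>_. \<alpha>)"
    and "\<forall>i<n. \<theta> i \<in> carrier_vec n"
    and "\<forall>i<n. \<forall>j<n. \<theta> i \<bullet>c \<theta> j = (if i = j then 1 else 0)"
    and "\<theta> 0 = vec n (\<lambda>_. complex_of_real (1 / sqrt (real n)))"
    and "\<forall>i<n. eigenvector (mat_adjoint (complex_mat C) * complex_mat C) (\<theta> i) (\<mu> i)"
    and "\<mu> 0 = 0"
    and "w0 \<in> carrier_vec n"
    and "impulse_response (- laplacian n B) w0 x"
    and "\<forall>t. y t = C *\<^sub>v x t"
  shows "set_integrable lborel {0..} (\<lambda>t. y t \<bullet>c y t) \<and>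
    complex_of_real (performance_metric y) = mat_trace (\<Sigma>_Q n R_inv w0 * \<Psi> n R bs \<theta> \<mu>) \<and>
    (\<forall>k\<in>{1..<length bs}. \<forall>l\<in>{1..<length bs}. \<forall>p q a b.
       p \<le> q \<and> q < block_size bs k \<and> a \<le> b \<and> b < block_size bs l \<longrightarrow>
       L2_inner (h_tilde bs l a b) (h_tilde bs k p q) =
         (- 1) ^ ((b - a) + (q - p)) * (fact ((b - a) + (q - p)) / (fact (b - a) * fact (q - p)))
         / (cnj (block_eigenvalue bs k) + block_eigenvalue bs l) ^ ((b - a) + (q - p) + 1))"
proof -
  let ?L = "laplacian n B" and ?ns = "map fst bs"
  obtain r \<alpha> where r: "globally_reachable n B r" and \<alpha>: "col R 0 = vec n (\<lambda>_. \<alpha>)"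
    using assms(3,10) by blast
  have L: "?L \<in> carrier_mat n n" by (simp add: laplacian_def)
  have Lc: "complex_mat ?L \<in> carrier_mat n n" using L by simp
  note S = similar_mat_wit_mult[OF assms(6) Lc]
  have n: "sum_list ?ns = n" using S(1) by (metis carrier_matD(1) jordan_matrix_dim(1))
  have xc: "x t \<in> carrier_vec n" for t
    using assms(16,17) by (simp add: impulse_response_def)
  have pos: "Re (cnj (block_eigenvalue bs k) + block_eigenvalue bs l) > 0"
    if "1 \<le> k" "k < length bs" "1 \<le> l" "l < length bs" for k l
    using laplacian_jordan_eigenvalue_pos[OF assms(2) r assms(6,7) \<alpha> that(1,2)]
      laplacian_jordan_eigenvalue_pos[OF assms(2) r assms(6,7) \<alpha> that(3,4)] by simp

  \<comment> \<open>From here on k and l count the blocks after the first, as in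
    \<open>\<Psi>\<close>; hence \<open>Suc k\<close> wherever \<open>bs\<close> is
    accessed.\<close>
  define m where "m = length bs - 1"
  define s where "s k = block_size bs (Suc k)" for k
  define o' where "o' k = block_offset ?ns (Suc k)" for k
  define W where "W k q = (R_inv *\<^sub>v complex_vec w0) $ (o' k + q)" for k q
  define N where "N k p l a = \<nu> n R \<theta> \<mu> (o' k + p) (o' l + a)" for k p l a
  define E where "E k p q = jordan_exp (block_eigenvalue bs (Suc k)) (q - p)" for k p q
  define I where "I k p q l a b = (LINT t:{0..}|lborel. cnj (E k p q t) * E l a b t)" for k p q l a b
  have ns0: "?ns \<noteq> []" "?ns ! 0 = 1" using assms(8,9) by (auto simp: nth_map)
  have sum_tail: "(\<Sum>i\<in>{1..<n}. f i) = (\<Sum>k<m. \<Sum>p<s k. f (o' k + p))" for f :: "nat \<Rightarrow> complex"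
    unfolding sum_blocks_tail[OF ns0 n] by (simp add: m_def s_def o'_def block_size_def)
  have modal: "(R_inv *\<^sub>v complex_vec (x t)) $ (o' k + p) = (\<Sum>q=p..<s k. E k p q t * W k q)"
    if "t \<ge> 0" "k < m" "p < s k" for t k p
    using that modal_solution[OF L assms(6,16,17), of "Suc k" p t]
    by (simp add: m_def s_def o'_def E_def W_def)

  have energy: "complex_of_real (y t \<bullet>c y t)
      = (\<Sum>k<m. \<Sum>q<s k. \<Sum>l<m. \<Sum>b<s l. \<Sum>p\<le>q. \<Sum>a\<le>b.
          (cnj (W k q) * W l b * N k p l a) * (cnj (E k p q t) * E l a b t))" if t: "t \<ge> 0" for t
  proof -
    have "complex_of_real (y t \<bullet>c y t) = (\<Sum>k<m. \<Sum>p<s k. cnj (\<Sum>q=p..<s k. E k p q t * W k q)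
        * (\<Sum>l<m. \<Sum>a<s l. (\<Sum>b=a..<s l. E l a b t * W l b) * N k p l a))"
      unfolding assms(18)[rule_format]
        output_energy_modal[OF assms(4,5) S(2,3,5) \<alpha> xc assms(11,12,14,15)] sum_tail
      by (intro sum.cong arg_cong2[where f="(*)"] arg_cong[where f=cnj] refl) (auto simp: modal[OF t] N_def)
    also have "\<dots> = (\<Sum>k<m. \<Sum>p<s k. \<Sum>q=p..<s k. \<Sum>l<m. \<Sum>a<s l. \<Sum>b=a..<s l.
        (cnj (W k q) * W l b * N k p l a) * (cnj (E k p q t) * E l a b t))"
      \<comment> \<open>The conjugated factor is expanded first, so that the sum over q stands
        outside those over l, a and b, as \<open>sum_block_rearrange\<close> requires.\<close>
      unfolding cnj_sum sum_distrib_right[of _ _ "sum _ _"]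
      unfolding sum_distrib_left sum_distrib_right
      by (intro sum.cong refl) (simp add: mult_ac)
    finally show ?thesis unfolding sum_block_rearrange .
  qed
  \<comment> \<open>\<open>has_bochner_integral\<close> carries integrability and value together
    through the finite sums.\<close>
  have basic: "has_bochner_integral lborel (\<lambda>t. indicator {0..} t *\<^sub>R (cnj (E k p q t) * E l a b t)) (I k p q l a b)"
    if "k < m" "l < m" for k l p q a b
    using set_integral_jordan_exp(1)[OF pos[of "Suc k" "Suc l"], of "q - p" "b - a"] that
    by (simp add: has_bochner_integral_iff set_integrable_def set_lebesgue_integral_def I_def E_def m_def)
  define V where "V = (\<Sum>k<m. \<Sum>q<s k. \<Sum>l<m. \<Sum>b<s l. \<Sum>p\<le>q. \<Sum>a\<le>b.
          (cnj (W k q) * W l b * N k p l a) * I k p q l a b)"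
  have "has_bochner_integral lborel (\<lambda>t. \<Sum>k<m. \<Sum>q<s k. \<Sum>l<m. \<Sum>b<s l. \<Sum>p\<le>q. \<Sum>a\<le>b.
      (cnj (W k q) * W l b * N k p l a) * (indicator {0..} t *\<^sub>R (cnj (E k p q t) * E l a b t))) V"
    unfolding V_def
    by (intro has_bochner_integral_sum has_bochner_integral_mult_right basic) auto
  also have "(\<lambda>t. \<Sum>k<m. \<Sum>q<s k. \<Sum>l<m. \<Sum>b<s l. \<Sum>p\<le>q. \<Sum>a\<le>b.
      (cnj (W k q) * W l b * N k p l a) * (indicator {0..} t *\<^sub>R (cnj (E k p q t) * E l a b t)))
      = (\<lambda>t. complex_of_real (indicator {0..} t *\<^sub>R (y t \<bullet>c y t)))"
  proof
    fix t :: real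
    show "(\<Sum>k<m. \<Sum>q<s k. \<Sum>l<m. \<Sum>b<s l. \<Sum>p\<le>q. \<Sum>a\<le>b.
      (cnj (W k q) * W l b * N k p l a) * (indicator {0..} t *\<^sub>R (cnj (E k p q t) * E l a b t)))
      = complex_of_real (indicator {0..} t *\<^sub>R (y t \<bullet>c y t))"
      using energy[of t] by (cases "t \<ge> 0") simp_all
  qed
  finally have V: "has_bochner_integral lborel (\<lambda>t. complex_of_real (indicator {0..} t *\<^sub>R (y t \<bullet>c y t))) V" .
  \<comment> \<open>With this the integral is the actual energy and not the default value 0 of a
    nonintegrable function.\<close>
  have integrable: "set_integrable lborel {0..} (\<lambda>t. y t \<bullet>c y t)"
    using V unfolding has_bochner_integral_iff set_integrable_def
    by (simp only: complex_of_real_integrable_eq)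
  have P: "complex_of_real (performance_metric y) = V"
    using V unfolding has_bochner_integral_iff performance_metric_def set_lebesgue_integral_def
    by (simp only: integral_complex_of_real)

  \<comment> \<open>Removing the leading block of size 1 lowers every offset by one;
    \<open>off\<close> is the numbering used by \<open>\<Psi>\<close> and
    \<open>\<Sigma>_Q\<close>.\<close>
  define off where "off k = block_offset (map fst (tl bs)) k" for k
  have bs: "bs = (1, 0) # tl bs" using assms(8,9) by (cases bs) auto
  have o'_off: "o' k = Suc (off k)" for k
    unfolding o'_def off_def by (subst bs) simp
  have len: "length (map fst (tl bs)) = m" by (simp add: m_def)
  have s_nth: "map fst (tl bs) ! k = s k" if "k < m" for k
    using that by (simp add: s_def block_size_def m_def nth_tl)
  have n1: "sum_list (map fst (tl bs)) = n - 1" using n by (subst (asm) bs) simp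
  have off_less: "off k + q < n - 1" if "k < m" "q < s k" for k q
    unfolding off_def using block_offset_add_less[of k "map fst (tl bs)" q] that s_nth by (simp add: len n1 m_def)
  have sum_off: "(\<Sum>i<n - 1. f i) = (\<Sum>k<m. \<Sum>q<s k. f (off k + q))" for f :: "nat \<Rightarrow> complex"
    unfolding n1[symmetric] sum_blocks len off_def[symmetric] by (intro sum.cong) (auto simp: s_nth)
  have \<Psi>: "\<Psi> n R bs \<theta> \<mu> $$ (off k + q, off l + b) = (\<Sum>p\<le>q. \<Sum>a\<le>b. N k p l a * I k p q l a b)"
    if "k < m" "q < s k" "l < m" "b < s l" for k q l b
  proof -
    have "\<Psi> n R bs \<theta> \<mu> $$ (off k + q, off l + b) = \<Psi>_block n R bs \<theta> \<mu> (Suc k) (Suc l) $$ (q, b)"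
      unfolding \<Psi>_def off_def using that by (intro block_mat_entry) (simp_all only: s_nth len)
    also have "\<dots> = (\<Sum>p\<le>q. \<Sum>a\<le>b. N k p l a * I k p q l a b)"
      using that unfolding \<Psi>_block_def
      by (auto simp: s_def N_def o'_def I_def E_def L2_inner_h_tilde intro!: sum.cong)
    finally show ?thesis .
  qed
  have \<Sigma>c: "\<Sigma>_Q n R_inv w0 \<in> carrier_mat (n - 1) (n - 1)"
    by (auto simp: \<Sigma>_Q_def Let_def Q_tilde_def mat_adjoint_def)
  have \<Psi>c: "\<Psi> n R bs \<theta> \<mu> \<in> carrier_mat (n - 1) (n - 1)"
    by (simp add: \<Psi>_def block_mat_def n1)
  have "mat_trace (\<Sigma>_Q n R_inv w0 * \<Psi> n R bs \<theta> \<mu>)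
      = (\<Sum>i<n - 1. \<Sum>j<n - 1. \<Sigma>_Q n R_inv w0 $$ (i, j) * \<Psi> n R bs \<theta> \<mu> $$ (j, i))"
    unfolding mat_trace_def using \<Sigma>c by (auto simp: mult_mat_sum[OF \<Sigma>c \<Psi>c] intro!: sum.cong)
  \<comment> \<open>The row index of \<open>\<Psi>\<close> is moved outside, since in
    \<open>V\<close> the outer pair k, q carries the conjugated initial value.\<close>
  also have "\<dots> = (\<Sum>j<n - 1. \<Sum>i<n - 1. \<Sigma>_Q n R_inv w0 $$ (i, j) * \<Psi> n R bs \<theta> \<mu> $$ (j, i))"
    by (rule sum.swap)
  also have "\<dots> = (\<Sum>k<m. \<Sum>q<s k. \<Sum>l<m. \<Sum>b<s l.
      \<Sigma>_Q n R_inv w0 $$ (off l + b, off k + q) * \<Psi> n R bs \<theta> \<mu> $$ (off k + q, off l + b))"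
    unfolding sum_off ..
  also have "\<dots> = V"
    unfolding V_def
  proof (intro sum.cong refl)
    fix k q l b assume "k \<in> {..<m}" "q \<in> {..<s k}" "l \<in> {..<m}" "b \<in> {..<s l}"
    then have kl: "k < m" "q < s k" "l < m" "b < s l" by auto
    have "\<Sigma>_Q n R_inv w0 $$ (off l + b, off k + q) = W l b * cnj (W k q)"
      using off_less[OF kl(1,2)] off_less[OF kl(3,4)]
      by (subst \<Sigma>_Q_entry[OF S(3) assms(16)]) (auto simp: W_def o'_off)
    then show "\<Sigma>_Q n R_inv w0 $$ (off l + b, off k + q) * \<Psi> n R bs \<theta> \<mu> $$ (off k + q, off l + b)
        = (\<Sum>p\<le>q. \<Sum>a\<le>b. (cnj (W k q) * W l b * N k p l a) * I k p q l a b)"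
      by (simp add: \<Psi>[OF kl] sum_distrib_left mult_ac)
  qed
  finally have trace: "mat_trace (\<Sigma>_Q n R_inv w0 * \<Psi> n R bs \<theta> \<mu>) = V" .

  show ?thesis
  proof (intro conjI ballI allI impI)
    show "complex_of_real (performance_metric y) = mat_trace (\<Sigma>_Q n R_inv w0 * \<Psi> n R bs \<theta> \<mu>)"
      by (simp only: P trace)
    fix k l p q a b
    assume "k \<in> {1..<length bs}" "l \<in> {1..<length bs}"
      and *: "p \<le> q \<and> q < block_size bs k \<and> a \<le> b \<and> b < block_size bs l"
    then have "Re (cnj (block_eigenvalue bs k) + block_eigenvalue bs l) > 0" by (intro pos) auto
    from set_integral_jordan_exp(2)[OF this] *
    show "L2_inner (h_tilde bs l a b) (h_tilde bs k p q) =
         (- 1) ^ ((b - a) + (q - p)) * (fact ((b - a) + (q - p)) / (fact (b - a) * fact (q - p)))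
         / (cnj (block_eigenvalue bs k) + block_eigenvalue bs l) ^ ((b - a) + (q - p) + 1)"
      by (simp only: L2_inner_h_tilde)
  qed (fact integrable)
qed

end
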